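(* Let $X$ be a (real) Banach space, $T(t)$ be a $C_0$ semigroup on it and $X\widehat{\otimes}_\pi X$ be its symmetric projective tensor product with itself. Then the positive cone $(X\widehat{\otimes}_\pi X)^+$ dual to $\mathcal{L}_s^+(X,X^* )$ is generating, i.e. $X\widehat{\otimes}_\pi X=(X\widehat{\otimes}_\pi X)^+-(X\widehat{\otimes}_\pi X)^+$, and the Lyapunov semigroup $\mathcal{T}(t)P:=T^*(t)PT(t)$ on $\mathcal{L}_s(X,X^* )$ is a $\pi$-compatible positive $C_b$ semigroup in the weak* topology $\sigma(\mathcal{L}_s(X,X^* ),X\widehat{\otimes}_\pi X)$.
   Context: $\mathcal{L}_s(X,X^* )$ is the space of bounded linear operators $P:X\to X^*$ that are symmetric, i.e. $\langle Px,y\rangle=\langle Py,x\rangle$ for all $x,y\in X$, with the operator norm; $\mathcal{L}_s^+(X,X^* )$ is the cone of those with $\langle Px,x\rangle\ge0$ for all $x\in X$. The projective tensor norm on the algebraic tensor product $X\otimes X$ is $\pi(\rho):=\inf\{\sum_i\|x_i\|\|y_i\| : \rho=\sum_i x_i\otimes y_i\}$, and $X\otimes_\pi X$ is the completion. $X\widehat{\otimes}X$ is the linear span in $X\otimes X$ of the tensors $x\otimes y+y\otimes x$, and $X\widehat{\otimes}_\pi X$ is its closure in $X\otimes_\pi X$, with norm $\pi$. The pairing $\langle\!\langle P,x\otimes y\rangle\!\rangle:=\langle Px,y\rangle$ identifies $\mathcal{L}_s(X,X^* )$ with the Banach dual $(X\widehat{\otimes}_\pi X)^*$. The dual cone is $(X\widehat{\otimes}_\pi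 X)^+:=\{\rho\in X\widehat{\otimes}_\pi X\mid\langle\!\langle P,\rho\rangle\!\rangle\ge0\ \forall P\in\mathcal{L}_s^+(X,X^* )\}$. A family of continuous linear operators $\mathcal{T}(t)$, $t\ge0$, on a locally convex space $\mathcal{X}$ is a $C_b$ semigroup if: (1) $\mathcal{T}(0)=I$, $\mathcal{T}(t+s)=\mathcal{T}(t)\mathcal{T}(s)$; (2) $t\mapsto\mathcal{T}(t)x$ is continuous on $[0,\infty)$ for all $x\in\mathcal{X}$; (3) for every continuous seminorm $p$ and every $a>0$, $x\mapsto\sup_{0\le t\le a}p(\mathcal{T}(t)x)$ is bounded on bounded subsets of $\mathcal{X}$. Here $\mathcal{X}=\mathcal{L}_s(X,X^* )$ with the weak* topology, whose dual is $\mathcal{X}'=X\widehat{\otimes}_\pi X$. The semigroup is positive if each $\mathcal{T}(t)$ maps $\mathcal{L}_s^+(X,X^* )$ into itself, and $\pi$-compatible if for every $\rho\in(X\widehat{\otimes}_\pi X)^+$ the function $t\mapsto\pi(\mathcal{T}'(t)\rho)$ is continuous, where $\mathcal{T}'(t)$ is the adjoint of $\mathcal{T}(t)$ acting on $X\widehat{\otimes}_\pi X$. *)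

theory Defs
  imports "HOL-Analysis.Analysis"
begin

section \<open>The algebraic tensor product\<close>

text \<open>A multiset of pairs stands for the finite sum of the corresponding elementary tensors; the
  tensor product is the free commutative monoid on \<open>X \<times> X\<close> modulo the congruence generated by
  bilinearity. It is a group because \<open>(- x, y)\<close> is inverse to \<open>(x, y)\<close>.\<close>

inductive tensor_cong :: "('a::real_vector \<times> 'a) multiset \<Rightarrow> ('a \<times> 'a) multiset \<Rightarrow> bool" where
  refl: "tensor_cong m m"
| sym: "tensor_cong m n \<Longrightarrow> tensor_cong n m"
| trans: "tensor_cong m n \<Longrightarrow> tensor_cong n k \<Longrightarrow> tensor_cong m k"
| add: "tensor_cong m n \<Longrightarrow> tensor_cong (m + k) (n + k)"
| zero: "tensor_cong {#(0, y)#} {#}"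
| add_left: "tensor_cong {#(x + x', y)#} {#(x, y), (x', y)#}"
| add_right: "tensor_cong {#(x, y + y')#} {#(x, y), (x, y')#}"
| scale: "tensor_cong {#(c *\<^sub>R x, y)#} {#(x, c *\<^sub>R y)#}"

lemma tensor_cong_add2:
  assumes "tensor_cong m m'" "tensor_cong n n'"
  shows "tensor_cong (m + n) (m' + n')"
  using assms tensor_cong.add[of m m' n] tensor_cong.add[of n n' m']
  by (metis tensor_cong.trans add.commute)

lemma tensor_cong_scaleR:
  assumes "tensor_cong m n"
  shows "tensor_cong (image_mset (\<lambda>(x, y). (c *\<^sub>R x, y)) m) (image_mset (\<lambda>(x, y). (c *\<^sub>R x, y)) n)"
  using assms
proof induction
  case (scale d x y)
  show ?case
    using tensor_cong.scale[of d "c *\<^sub>R x" y] by (simp add: mult.commute)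
qed (auto intro: tensor_cong.intros simp: scaleR_add_right)

quotient_type (overloaded) 'a tensor = "('a::real_vector \<times> 'a) multiset" / tensor_cong
  by (intro equivpI reflpI sympI transpI) (blast intro: tensor_cong.intros)+

instantiation tensor :: (real_vector) real_vector
begin

lift_definition zero_tensor :: "'a tensor" is "{#}" .

lift_definition plus_tensor :: "'a tensor \<Rightarrow> 'a tensor \<Rightarrow> 'a tensor" is "(+)"
  by (rule tensor_cong_add2)

lift_definition scaleR_tensor :: "real \<Rightarrow> 'a tensor \<Rightarrow> 'a tensor"
  is "\<lambda>c. image_mset (\<lambda>(x, y). (c *\<^sub>R x, y))"
  by (rule tensor_cong_scaleR)

definition uminus_tensor :: "'a tensor \<Rightarrow> 'a tensor" where
  "uminus_tensor \<rho> = (-1) *\<^sub>R \<rho>"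

definition minus_tensor :: "'a tensor \<Rightarrow> 'a tensor \<Rightarrow> 'a tensor" where
  "minus_tensor \<rho> \<sigma> = \<rho> + - \<sigma>"

instance
proof
  fix a b :: real and \<rho> \<sigma> \<tau> :: "'a tensor"
  show "\<rho> + \<sigma> + \<tau> = \<rho> + (\<sigma> + \<tau>)"
    by transfer (simp add: add.assoc tensor_cong.refl)
  show "\<rho> + \<sigma> = \<sigma> + \<rho>"
    by transfer (simp add: add.commute tensor_cong.refl)
  show "0 + \<rho> = \<rho>"
    by transfer (simp add: tensor_cong.refl)
  show distrib: "(a + b) *\<^sub>R \<rho> = a *\<^sub>R \<rho> + b *\<^sub>R \<rho>" for a b and \<rho> :: "'a tensor"
  proof transfer
    fix a b and m :: "('a \<times> 'a) multiset"
    let ?S = "\<lambda>c. image_mset (\<lambda>(x, y). (c *\<^sub>R x, y :: 'a))"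
    show "tensor_cong (?S (a + b) m) (?S a m + ?S b m)"
    proof (induction m)
      case (add z m)
      obtain x y where z: "z = (x, y)" by fastforce
      have "tensor_cong ({#((a + b) *\<^sub>R x, y)#} + ?S (a + b) m)
          ({#(a *\<^sub>R x, y), (b *\<^sub>R x, y)#} + (?S a m + ?S b m))"
        using tensor_cong_add2[OF tensor_cong.add_left add.IH] by (simp add: scaleR_add_left)
      then show ?case by (simp add: z add_mset_commute)
    qed (simp add: tensor_cong.refl)
  qed
  show one: "1 *\<^sub>R \<rho> = \<rho>" for \<rho> :: "'a tensor"
    by transfer (simp add: tensor_cong.refl case_prod_eta)
  have zero: "0 *\<^sub>R \<rho> = (0 :: 'a tensor)" for \<rho>
  proof transfer
    fix m :: "('a \<times> 'a) multiset"
    show "tensor_cong (image_mset (\<lambda>(x, y). (0 *\<^sub>R x, y)) m) {#}"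
    proof (induction m)
      case (add z m)
      then show ?case
        using tensor_cong_add2[OF tensor_cong.zero add.IH, of "snd z"] by (cases z) simp
    qed (simp add: tensor_cong.refl)
  qed
  show "- \<rho> + \<rho> = 0"
    using distrib[of "-1" 1 \<rho>] by (simp add: uminus_tensor_def one zero)
  show "\<rho> - \<sigma> = \<rho> + - \<sigma>"
    by (simp add: minus_tensor_def)
  show "a *\<^sub>R (\<rho> + \<sigma>) = a *\<^sub>R \<rho> + a *\<^sub>R \<sigma>"
    by transfer (simp add: tensor_cong.refl)
  show "a *\<^sub>R b *\<^sub>R \<rho> = (a * b) *\<^sub>R \<rho>"
    by transfer (simp add: tensor_cong.refl image_mset.compositionality o_def case_prod_unfold)
qed

end

lift_definition elem_tensor :: "'a::real_vector \<Rightarrow> 'a \<Rightarrow> 'a tensor" (infixr \<open>\<otimes>\<close> 75)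
  is "\<lambda>x y. {#(x, y)#}" .

lemma elem_tensor_bilinear: "bilinear (\<otimes>)"
  unfolding bilinear_def
proof (intro conjI allI linearI)
  fix x x' y y' :: 'a and c :: real
  show "(x + x') \<otimes> y = x \<otimes> y + x' \<otimes> y"
    by transfer (use tensor_cong.add_left in \<open>simp add: add_mset_commute\<close>)
  show "x \<otimes> (y + y') = x \<otimes> y + x \<otimes> y'"
    by transfer (use tensor_cong.add_right in \<open>simp add: add_mset_commute\<close>)
  show "(c *\<^sub>R x) \<otimes> y = c *\<^sub>R (x \<otimes> y)"
    by transfer (simp add: tensor_cong.refl)
  show "x \<otimes> (c *\<^sub>R y) = c *\<^sub>R (x \<otimes> y)"
    by transfer (simp add: tensor_cong.sym[OF tensor_cong.scale])
qed

lemma abs_tensor_eq_sum: "abs_tensor m = (\<Sum>(x, y)\<in>#m. x \<otimes> y)"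
proof (induction m)
  case (add z m)
  have "abs_tensor (add_mset z m) = abs_tensor {#z#} + abs_tensor m"
    by (simp add: plus_tensor.abs_eq)
  then show ?case
    using add by (cases z) (simp add: elem_tensor.abs_eq)
qed (simp add: zero_tensor_def)

lemma ex_tensor_representation: "\<exists>m. \<rho> = (\<Sum>(x, y)\<in>#m. x \<otimes> y)"
  by (metis Quotient_tensor Quotient_abs_rep abs_tensor_eq_sum)


section \<open>The projective norm\<close>

definition proj_norm :: "'a::real_normed_vector tensor \<Rightarrow> real" where
  "proj_norm \<rho> = Inf {\<Sum>(x, y)\<in>#m. norm x * norm y | m. \<rho> = (\<Sum>(x, y)\<in>#m. x \<otimes> y)}"

lemma sum_mset_norm_nonneg: "0 \<le> (\<Sum>(x, y)\<in>#m. norm x * norm y)"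
  by (induction m) auto

lemma proj_norm_le: "proj_norm (\<Sum>(x, y)\<in>#m. x \<otimes> y) \<le> (\<Sum>(x, y)\<in>#m. norm x * norm y)"
  unfolding proj_norm_def
  by (rule cInf_lower) (auto intro!: bdd_belowI[where m = 0] sum_mset_norm_nonneg)

lemma proj_norm_nonneg: "0 \<le> proj_norm \<rho>"
  unfolding proj_norm_def
  by (rule cInf_greatest) (use ex_tensor_representation[of \<rho>] in \<open>auto intro: sum_mset_norm_nonneg\<close>)

lemma proj_norm_approx:
  assumes "proj_norm \<rho> < e"
  obtains m where "\<rho> = (\<Sum>(x, y)\<in>#m. x \<otimes> y)" "(\<Sum>(x, y)\<in>#m. norm x * norm y) < e"
proof -
  have "{\<Sum>(x, y)\<in>#m. norm x * norm y | m. \<rho> = (\<Sum>(x, y)\<in>#m. x \<otimes> y)} \<noteq> {}"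
    using ex_tensor_representation[of \<rho>] by auto
  from cInf_lessD[OF this] assms show ?thesis
    unfolding proj_norm_def using that by auto
qed

lemma proj_norm_triangle: "proj_norm (\<rho> + \<sigma>) \<le> proj_norm \<rho> + proj_norm \<sigma>"
proof (rule field_le_epsilon)
  fix e :: real assume "e > 0"
  obtain m where m: "\<rho> = (\<Sum>(x, y)\<in>#m. x \<otimes> y)"
    "(\<Sum>(x, y)\<in>#m. norm x * norm y) < proj_norm \<rho> + e / 2"
    using proj_norm_approx[of \<rho> "proj_norm \<rho> + e / 2"] \<open>e > 0\<close> by auto
  obtain n where n: "\<sigma> = (\<Sum>(x, y)\<in>#n. x \<otimes> y)"
    "(\<Sum>(x, y)\<in>#n. norm x * norm y) < proj_norm \<sigma> + e / 2"
    using proj_norm_approx[of \<sigma> "proj_norm \<sigma> + e / 2"] \<open>e > 0\<close> by auto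
  show "proj_norm (\<rho> + \<sigma>) \<le> proj_norm \<rho> + proj_norm \<sigma> + e"
    using proj_norm_le[of "m + n"] m n by simp
qed

lemma proj_norm_zero [simp]: "proj_norm (0 :: 'a::real_normed_vector tensor) = 0"
  using proj_norm_le[of "{#} :: ('a \<times> 'a) multiset"] proj_norm_nonneg[of "0 :: 'a tensor"]
  by simp

lemma proj_norm_scaleR: "proj_norm (c *\<^sub>R \<rho>) = \<bar>c\<bar> * proj_norm \<rho>"
proof -
  have le: "proj_norm (c *\<^sub>R \<rho>) \<le> \<bar>c\<bar> * proj_norm \<rho>" if "c \<noteq> 0" for c and \<rho> :: "'a tensor"
  proof (rule field_le_epsilon)
    fix e :: real assume "e > 0"
    then obtain m where m: "\<rho> = (\<Sum>(x, y)\<in>#m. x \<otimes> y)"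
      "(\<Sum>(x, y)\<in>#m. norm x * norm y) < proj_norm \<rho> + e / \<bar>c\<bar>"
      using proj_norm_approx[of \<rho> "proj_norm \<rho> + e / \<bar>c\<bar>"] \<open>c \<noteq> 0\<close> by auto
    let ?m = "image_mset (\<lambda>(x, y). (c *\<^sub>R x, y)) m"
    have 1: "(\<Sum>(x, y)\<in>#?m. x \<otimes> y) = c *\<^sub>R (\<Sum>(x, y)\<in>#m. x \<otimes> y)"
      by (induction m) (auto simp: scaleR_add_right bilinear_lmul[OF elem_tensor_bilinear])
    have 2: "(\<Sum>(x, y)\<in>#?m. norm x * norm y) = \<bar>c\<bar> * (\<Sum>(x, y)\<in>#m. norm x * norm y)"
      by (induction m) (auto simp: algebra_simps)
    have "\<bar>c\<bar> * (\<Sum>(x, y)\<in>#m. norm x * norm y) \<le> \<bar>c\<bar> * (proj_norm \<rho> + e / \<bar>c\<bar>)"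
      using m(2) by (intro mult_left_mono) auto
    also have "\<dots> = \<bar>c\<bar> * proj_norm \<rho> + e"
      using \<open>c \<noteq> 0\<close> by (simp add: distrib_left)
    finally have "\<bar>c\<bar> * (\<Sum>(x, y)\<in>#m. norm x * norm y) \<le> \<bar>c\<bar> * proj_norm \<rho> + e" .
    then show "proj_norm (c *\<^sub>R \<rho>) \<le> \<bar>c\<bar> * proj_norm \<rho> + e"
      using proj_norm_le[of ?m] unfolding 1 2 m(1)[symmetric] by linarith
  qed
  show ?thesis
  proof (cases "c = 0")
    case False
    have "\<bar>c\<bar> * proj_norm \<rho> \<le> \<bar>c\<bar> * (\<bar>inverse c\<bar> * proj_norm (c *\<^sub>R \<rho>))"
      using le[of "inverse c" "c *\<^sub>R \<rho>"] False by (intro mult_left_mono) auto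
    then show ?thesis
      using le[OF False, of \<rho>] False by (simp add: field_simps)
  qed simp
qed

lemma proj_norm_minus_commute: "proj_norm (\<rho> - \<sigma>) = proj_norm (\<sigma> - \<rho>)"
  using proj_norm_scaleR[of "-1" "\<sigma> - \<rho>"] by simp

lemma proj_norm_triangle_diff: "\<bar>proj_norm \<rho> - proj_norm \<sigma>\<bar> \<le> proj_norm (\<rho> - \<sigma>)"
  using proj_norm_triangle[of "\<rho> - \<sigma>" \<sigma>] proj_norm_triangle[of "\<sigma> - \<rho>" \<rho>]
    proj_norm_minus_commute[of \<rho> \<sigma>] by simp


section \<open>The completed projective tensor product\<close>

definition proj_Cauchy :: "(nat \<Rightarrow> 'a::real_normed_vector tensor) \<Rightarrow> bool" where
  "proj_Cauchy s \<longleftrightarrow> (\<forall>e>0. \<exists>N. \<forall>m\<ge>N. \<forall>n\<ge>N. proj_norm (s m - s n) < e)"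

definition proj_equiv ::
    "(nat \<Rightarrow> 'a::real_normed_vector tensor) \<Rightarrow> (nat \<Rightarrow> 'a tensor) \<Rightarrow> bool" where
  "proj_equiv s t \<longleftrightarrow> proj_Cauchy s \<and> proj_Cauchy t \<and> (\<lambda>n. proj_norm (s n - t n)) \<longlonglongrightarrow> 0"

lemma proj_Cauchy_const [simp]: "proj_Cauchy (\<lambda>_. \<rho>)"
  by (simp add: proj_Cauchy_def)

lemma proj_Cauchy_add:
  assumes "proj_Cauchy s" "proj_Cauchy t"
  shows "proj_Cauchy (\<lambda>n. s n + t n)"
  unfolding proj_Cauchy_def
proof (intro allI impI)
  fix e :: real assume "e > 0"
  then obtain M N where M: "\<forall>m\<ge>M. \<forall>n\<ge>M. proj_norm (s m - s n) < e / 2"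
    and N: "\<forall>m\<ge>N. \<forall>n\<ge>N. proj_norm (t m - t n) < e / 2"
    using assms unfolding proj_Cauchy_def by (meson half_gt_zero)
  have "proj_norm (s m + t m - (s n + t n)) < e" if "m \<ge> max M N" "n \<ge> max M N" for m n
  proof -
    have "proj_norm (s m - s n) < e / 2" "proj_norm (t m - t n) < e / 2"
      using M N that by auto
    then show ?thesis
      using proj_norm_triangle[of "s m - s n" "t m - t n"] by (simp add: algebra_simps)
  qed
  then show "\<exists>N. \<forall>m\<ge>N. \<forall>n\<ge>N. proj_norm (s m + t m - (s n + t n)) < e" by blast
qed

lemma proj_Cauchy_scaleR:
  assumes "proj_Cauchy s"
  shows "proj_Cauchy (\<lambda>n. c *\<^sub>R s n)"
proof (cases "c = 0")
  case False
  show ?thesis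
    unfolding proj_Cauchy_def
  proof (intro allI impI)
    fix e :: real assume "e > 0"
    then obtain N where N: "\<forall>m\<ge>N. \<forall>n\<ge>N. proj_norm (s m - s n) < e / \<bar>c\<bar>"
      using assms False unfolding proj_Cauchy_def by (meson divide_pos_pos zero_less_abs_iff)
    have "proj_norm (c *\<^sub>R s m - c *\<^sub>R s n) < e" if "m \<ge> N" "n \<ge> N" for m n
      using N that False
      by (simp add: scaleR_diff_right[symmetric] proj_norm_scaleR pos_less_divide_eq mult.commute)
    then show "\<exists>N. \<forall>m\<ge>N. \<forall>n\<ge>N. proj_norm (c *\<^sub>R s m - c *\<^sub>R s n) < e" by blast
  qed
qed simp

lemma proj_Cauchy_norm_Cauchy:
  assumes "proj_Cauchy s"
  shows "Cauchy (\<lambda>n. proj_norm (s n))"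
proof (rule metric_CauchyI)
  fix e :: real assume "e > 0"
  then obtain N where "\<forall>m\<ge>N. \<forall>n\<ge>N. proj_norm (s m - s n) < e"
    using assms unfolding proj_Cauchy_def by blast
  then show "\<exists>N. \<forall>m\<ge>N. \<forall>n\<ge>N. dist (proj_norm (s m)) (proj_norm (s n)) < e"
    by (metis dist_real_def order_le_less_trans proj_norm_triangle_diff)
qed

lemma proj_Cauchy_norm_LIMSEQ:
  "proj_Cauchy s \<Longrightarrow> (\<lambda>n. proj_norm (s n)) \<longlonglongrightarrow> lim (\<lambda>n. proj_norm (s n))"
  using proj_Cauchy_norm_Cauchy Cauchy_convergent convergent_LIMSEQ_iff by blast

lemma proj_equiv_refl: "proj_Cauchy s \<Longrightarrow> proj_equiv s s"
  by (simp add: proj_equiv_def)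

lemma proj_equiv_sym: "proj_equiv s t \<Longrightarrow> proj_equiv t s"
  by (simp add: proj_equiv_def proj_norm_minus_commute)

lemma proj_equiv_trans:
  assumes "proj_equiv s t" "proj_equiv t u"
  shows "proj_equiv s u"
proof -
  have "(\<lambda>n. proj_norm (s n - t n) + proj_norm (t n - u n)) \<longlonglongrightarrow> 0 + 0"
    using assms by (intro tendsto_add) (auto simp: proj_equiv_def)
  then have "(\<lambda>n. proj_norm (s n - u n)) \<longlonglongrightarrow> 0"
  proof (rule Lim_null_comparison[OF always_eventually, OF allI, rotated, OF tendsto_eq_rhs])
    fix n
    have eq: "s n - u n = (s n - t n) + (t n - u n)"
      by simp
    show "norm (proj_norm (s n - u n)) \<le> proj_norm (s n - t n) + proj_norm (t n - u n)"
      unfolding eq using proj_norm_triangle[of "s n - t n" "t n - u n"]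
      by (simp only: real_norm_def abs_of_nonneg[OF proj_norm_nonneg])
  qed simp
  then show ?thesis
    using assms by (simp add: proj_equiv_def)
qed

lemma proj_equiv_add:
  assumes "proj_equiv s s'" "proj_equiv t t'"
  shows "proj_equiv (\<lambda>n. s n + t n) (\<lambda>n. s' n + t' n)"
proof -
  have "(\<lambda>n. proj_norm (s n - s' n) + proj_norm (t n - t' n)) \<longlonglongrightarrow> 0 + 0"
    using assms by (intro tendsto_add) (auto simp: proj_equiv_def)
  then have "(\<lambda>n. proj_norm (s n + t n - (s' n + t' n))) \<longlonglongrightarrow> 0"
  proof (rule Lim_null_comparison[OF always_eventually, OF allI, rotated, OF tendsto_eq_rhs])
    fix n
    have eq: "s n + t n - (s' n + t' n) = (s n - s' n) + (t n - t' n)"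
      by simp
    show "norm (proj_norm (s n + t n - (s' n + t' n))) \<le> proj_norm (s n - s' n) + proj_norm (t n - t' n)"
      unfolding eq using proj_norm_triangle[of "s n - s' n" "t n - t' n"]
      by (simp only: real_norm_def abs_of_nonneg[OF proj_norm_nonneg])
  qed simp
  then show ?thesis
    using assms by (simp add: proj_equiv_def proj_Cauchy_add)
qed

lemma proj_equiv_scaleR:
  assumes "proj_equiv s t"
  shows "proj_equiv (\<lambda>n. c *\<^sub>R s n) (\<lambda>n. c *\<^sub>R t n)"
proof -
  have "(\<lambda>n. \<bar>c\<bar> * proj_norm (s n - t n)) \<longlonglongrightarrow> \<bar>c\<bar> * 0"
    using assms by (intro tendsto_mult tendsto_const) (auto simp: proj_equiv_def)
  then show ?thesis
    using assms
    by (simp add: proj_equiv_def proj_Cauchy_scaleR scaleR_diff_right[symmetric] proj_norm_scaleR)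
qed

lemma proj_equiv_norm_lim:
  assumes "proj_equiv s t"
  shows "lim (\<lambda>n. proj_norm (s n)) = lim (\<lambda>n. proj_norm (t n))"
proof -
  have s: "proj_Cauchy s" and t: "proj_Cauchy t" and "(\<lambda>n. proj_norm (s n - t n)) \<longlonglongrightarrow> 0"
    using assms by (auto simp: proj_equiv_def)
  then have "(\<lambda>n. proj_norm (s n) - proj_norm (t n)) \<longlonglongrightarrow> 0"
    by (rule_tac Lim_null_comparison[of _ "\<lambda>n. proj_norm (s n - t n)"])
       (auto simp: proj_norm_triangle_diff)
  moreover have "(\<lambda>n. proj_norm (s n) - proj_norm (t n)) \<longlonglongrightarrow>
      lim (\<lambda>n. proj_norm (s n)) - lim (\<lambda>n. proj_norm (t n))"
    by (intro tendsto_diff proj_Cauchy_norm_LIMSEQ s t)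
  ultimately show ?thesis
    using LIMSEQ_unique by fastforce
qed

text \<open>The completion of \<open>X \<otimes> X\<close> with respect to \<open>\<pi>\<close>: Cauchy sequences modulo null sequences. This
  needs only that \<open>\<pi>\<close> is a seminorm on the algebraic tensor product, so its definiteness (a
  consequence of the Hahn--Banach theorem) is not presupposed.\<close>

quotient_type (overloaded) 'a ptensor = "nat \<Rightarrow> 'a::real_normed_vector tensor" / partial: proj_equiv
proof (rule part_equivpI)
  show "\<exists>s. proj_equiv s s"
    using proj_equiv_refl[OF proj_Cauchy_const] by blast
  show "symp proj_equiv"
    by (rule sympI) (rule proj_equiv_sym)
  show "transp proj_equiv"
    by (rule transpI) (rule proj_equiv_trans)
qed

definition of_tensor :: "'a::real_normed_vector tensor \<Rightarrow> 'a ptensor" where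
  "of_tensor \<rho> = abs_ptensor (\<lambda>_. \<rho>)"

instantiation ptensor :: (real_normed_vector) real_normed_vector
begin

lift_definition zero_ptensor :: "'a ptensor" is "\<lambda>n. 0"
  by (simp add: proj_equiv_refl)

lift_definition plus_ptensor :: "'a ptensor \<Rightarrow> 'a ptensor \<Rightarrow> 'a ptensor" is "\<lambda>s t n. s n + t n"
  by (rule proj_equiv_add)

lift_definition scaleR_ptensor :: "real \<Rightarrow> 'a ptensor \<Rightarrow> 'a ptensor" is "\<lambda>c s n. c *\<^sub>R s n"
  by (rule proj_equiv_scaleR)

lift_definition norm_ptensor :: "'a ptensor \<Rightarrow> real" is "\<lambda>s. lim (\<lambda>n. proj_norm (s n))"
  by (rule proj_equiv_norm_lim)

definition uminus_ptensor :: "'a ptensor \<Rightarrow> 'a ptensor" where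
  "uminus_ptensor \<rho> = (-1) *\<^sub>R \<rho>"

definition minus_ptensor :: "'a ptensor \<Rightarrow> 'a ptensor \<Rightarrow> 'a ptensor" where
  "minus_ptensor \<rho> \<sigma> = \<rho> + - \<sigma>"

definition dist_ptensor :: "'a ptensor \<Rightarrow> 'a ptensor \<Rightarrow> real" where
  "dist_ptensor \<rho> \<sigma> = norm (\<rho> - \<sigma>)"

definition sgn_ptensor :: "'a ptensor \<Rightarrow> 'a ptensor" where
  "sgn_ptensor \<rho> = inverse (norm \<rho>) *\<^sub>R \<rho>"

definition uniformity_ptensor :: "('a ptensor \<times> 'a ptensor) filter" where
  "uniformity_ptensor = (INF e\<in>{0 <..}. principal {(x, y). dist x y < e})"

definition open_ptensor :: "'a ptensor set \<Rightarrow> bool" where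
  "open_ptensor S = (\<forall>x\<in>S. \<forall>\<^sub>F (x', y) in uniformity. x' = x \<longrightarrow> y \<in> S)"

instance
proof
  fix a b :: real and \<rho> \<sigma> \<tau> :: "'a ptensor"
  show "\<rho> + \<sigma> + \<tau> = \<rho> + (\<sigma> + \<tau>)"
    by transfer (auto simp: proj_equiv_def add.assoc intro!: proj_Cauchy_add)
  show "\<rho> + \<sigma> = \<sigma> + \<rho>"
    by transfer (auto simp: proj_equiv_def add.commute intro!: proj_Cauchy_add)
  show "0 + \<rho> = \<rho>"
    by transfer (auto simp: proj_equiv_def)
  show "- \<rho> + \<rho> = 0"
    unfolding uminus_ptensor_def by transfer (auto intro!: proj_equiv_refl)
  show "\<rho> - \<sigma> = \<rho> + - \<sigma>"
    by (simp add: minus_ptensor_def)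
  show "a *\<^sub>R (\<rho> + \<sigma>) = a *\<^sub>R \<rho> + a *\<^sub>R \<sigma>"
    by transfer (auto simp: proj_equiv_def scaleR_add_right intro!: proj_Cauchy_add proj_Cauchy_scaleR)
  show "(a + b) *\<^sub>R \<rho> = a *\<^sub>R \<rho> + b *\<^sub>R \<rho>"
    by transfer (auto simp: proj_equiv_def scaleR_add_left intro!: proj_Cauchy_add proj_Cauchy_scaleR)
  show "a *\<^sub>R b *\<^sub>R \<rho> = (a * b) *\<^sub>R \<rho>"
    by transfer (auto simp: proj_equiv_def intro!: proj_Cauchy_scaleR)
  show "1 *\<^sub>R \<rho> = \<rho>"
    by transfer (auto simp: proj_equiv_def)
  show "dist \<rho> \<sigma> = norm (\<rho> - \<sigma>)"
    by (rule dist_ptensor_def)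
  show "sgn \<rho> = inverse (norm \<rho>) *\<^sub>R \<rho>"
    by (rule sgn_ptensor_def)
  show "uniformity = (INF e\<in>{0 <..}. principal {(x, y :: 'a ptensor). dist x y < e})"
    by (rule uniformity_ptensor_def)
  show "open U = (\<forall>x\<in>U. \<forall>\<^sub>F (x', y) in uniformity. x' = x \<longrightarrow> y \<in> U)" for U :: "'a ptensor set"
    by (rule open_ptensor_def)
  show "norm \<rho> = 0 \<longleftrightarrow> \<rho> = 0"
  proof transfer
    fix s :: "nat \<Rightarrow> 'a tensor"
    assume "proj_equiv s s"
    then have s: "proj_Cauchy s" by (simp add: proj_equiv_def)
    show "lim (\<lambda>n. proj_norm (s n)) = 0 \<longleftrightarrow> proj_equiv s (\<lambda>n. 0)"
    proof
      assume "lim (\<lambda>n. proj_norm (s n)) = 0"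
      then show "proj_equiv s (\<lambda>n. 0)"
        using proj_Cauchy_norm_LIMSEQ[OF s] s by (simp add: proj_equiv_def)
    next
      assume "proj_equiv s (\<lambda>n. 0)"
      then show "lim (\<lambda>n. proj_norm (s n)) = 0"
        by (intro limI) (simp add: proj_equiv_def)
    qed
  qed
  show "norm (\<rho> + \<sigma>) \<le> norm \<rho> + norm \<sigma>"
  proof transfer
    fix s t :: "nat \<Rightarrow> 'a tensor"
    assume "proj_equiv s s" "proj_equiv t t"
    then have "proj_Cauchy s" "proj_Cauchy t" by (auto simp: proj_equiv_def)
    then show "lim (\<lambda>n. proj_norm (s n + t n)) \<le> lim (\<lambda>n. proj_norm (s n)) + lim (\<lambda>n. proj_norm (t n))"
      by (intro LIMSEQ_le[OF proj_Cauchy_norm_LIMSEQ tendsto_add[OF proj_Cauchy_norm_LIMSEQ proj_Cauchy_norm_LIMSEQ]])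
         (auto intro: proj_Cauchy_add proj_norm_triangle)
  qed
  show "norm (a *\<^sub>R \<rho>) = \<bar>a\<bar> * norm \<rho>"
  proof transfer
    fix a :: real and s :: "nat \<Rightarrow> 'a tensor"
    assume "proj_equiv s s"
    then have "proj_Cauchy s" by (simp add: proj_equiv_def)
    then show "lim (\<lambda>n. proj_norm (a *\<^sub>R s n)) = \<bar>a\<bar> * lim (\<lambda>n. proj_norm (s n))"
      unfolding proj_norm_scaleR
      by (intro limI tendsto_mult tendsto_const proj_Cauchy_norm_LIMSEQ)
  qed
qed

end

lemma linear_of_tensor: "linear of_tensor"
  by (rule linearI)
     (simp_all add: of_tensor_def plus_ptensor.abs_eq scaleR_ptensor.abs_eq proj_equiv_refl)

lemma norm_of_tensor [simp]: "norm (of_tensor \<rho>) = proj_norm \<rho>"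
  by (simp add: of_tensor_def norm_ptensor.abs_eq proj_equiv_refl)

lemma abs_ptensor_LIMSEQ:
  assumes "proj_Cauchy s"
  shows "(\<lambda>k. of_tensor (s k)) \<longlonglongrightarrow> abs_ptensor s"
proof (rule metric_LIMSEQ_I)
  fix e :: real assume "e > 0"
  then obtain N where N: "\<forall>m\<ge>N. \<forall>n\<ge>N. proj_norm (s m - s n) < e / 2"
    using assms unfolding proj_Cauchy_def by (meson half_gt_zero)
  have "dist (of_tensor (s k)) (abs_ptensor s) < e" if "k \<ge> N" for k
  proof -
    have d: "proj_Cauchy (\<lambda>n. s k + (-1) *\<^sub>R s n)"
      using assms by (intro proj_Cauchy_add proj_Cauchy_scaleR) auto
    have "of_tensor (s k) - abs_ptensor s = of_tensor (s k) + (-1) *\<^sub>R abs_ptensor s"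
      by (simp only: minus_ptensor_def uminus_ptensor_def)
    also have "(-1) *\<^sub>R abs_ptensor s = abs_ptensor (\<lambda>n. (-1) *\<^sub>R s n)"
      by (rule scaleR_ptensor.abs_eq[OF proj_equiv_refl[OF assms]])
    also have "of_tensor (s k) + \<dots> = abs_ptensor (\<lambda>n. s k + (-1) *\<^sub>R s n)"
      unfolding of_tensor_def
      by (rule plus_ptensor.abs_eq[OF proj_equiv_refl[OF proj_Cauchy_const]
            proj_equiv_refl[OF proj_Cauchy_scaleR[OF assms]]])
    finally have "of_tensor (s k) - abs_ptensor s = abs_ptensor (\<lambda>n. s k + (-1) *\<^sub>R s n)" .
    then have "dist (of_tensor (s k)) (abs_ptensor s) = lim (\<lambda>n. proj_norm (s k - s n))"
      using d by (simp add: dist_norm norm_ptensor.abs_eq proj_equiv_refl)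
    also have "\<dots> \<le> e / 2"
      using proj_Cauchy_norm_LIMSEQ[OF d] N that
      by (intro LIMSEQ_le_const2[of "\<lambda>n. proj_norm (s k - s n)"] exI[of _ N])
         (auto intro: less_imp_le)
    finally show ?thesis using \<open>e > 0\<close> by simp
  qed
  then show "\<exists>N. \<forall>k\<ge>N. dist (of_tensor (s k)) (abs_ptensor s) < e" by blast
qed

lemma ptensor_exhaust:
  obtains s where "proj_Cauchy s" "\<rho> = abs_ptensor s"
proof -
  have "proj_equiv (rep_ptensor \<rho>) (rep_ptensor \<rho>)"
    by (rule Quotient_rep_reflp[OF Quotient_ptensor])
  moreover have "\<rho> = abs_ptensor (rep_ptensor \<rho>)"
    by (rule Quotient_abs_rep[OF Quotient_ptensor, symmetric])
  ultimately show ?thesis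
    using that proj_equiv_def by blast
qed

lemma closure_range_of_tensor: "closure (range of_tensor) = UNIV"
proof -
  have "\<rho> \<in> closure (range of_tensor)" for \<rho> :: "'a ptensor"
  proof -
    obtain s where s: "proj_Cauchy s" "\<rho> = abs_ptensor s"
      by (rule ptensor_exhaust)
    have "\<forall>k. of_tensor (s k) \<in> range of_tensor" by blast
    moreover have "(\<lambda>k. of_tensor (s k)) \<longlonglongrightarrow> \<rho>"
      unfolding s(2) by (rule abs_ptensor_LIMSEQ[OF s(1)])
    ultimately show ?thesis
      unfolding closure_sequential by (intro exI[of _ "\<lambda>k. of_tensor (s k)"] conjI)
  qed
  then show ?thesis by blast
qed

instance ptensor :: (real_normed_vector) banach
proof
  fix X :: "nat \<Rightarrow> 'a ptensor"
  assume X: "Cauchy X"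
  have "\<exists>\<rho>. dist (of_tensor \<rho>) (X n) < inverse (real (Suc n))" for n
    using closure_range_of_tensor[where ?'a = 'a] closure_approachable[of "X n" "range of_tensor"]
    by (metis UNIV_I inverse_positive_iff_positive of_nat_0_less_iff rangeE zero_less_Suc)
  then obtain s where s: "dist (of_tensor (s n)) (X n) < inverse (real (Suc n))" for n
    by metis
  then have *: "(\<lambda>n. dist (of_tensor (s n)) (X n)) \<longlonglongrightarrow> 0"
    by (intro tendsto_sandwich[OF _ _ tendsto_const LIMSEQ_inverse_real_of_nat])
       (auto intro!: always_eventually less_imp_le)
  have "proj_Cauchy s"
    unfolding proj_Cauchy_def
  proof (intro allI impI)
    fix e :: real assume "e > 0"
    then obtain M N where M: "\<forall>n\<ge>M. dist (of_tensor (s n)) (X n) < e / 3"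
      and N: "\<forall>m\<ge>N. \<forall>n\<ge>N. dist (X m) (X n) < e / 3"
      using metric_LIMSEQ_D[OF *, of "e / 3"] metric_CauchyD[OF X, of "e / 3"] by auto
    have "proj_norm (s m - s n) < e" if "m \<ge> max M N" "n \<ge> max M N" for m n
    proof -
      have "proj_norm (s m - s n) = dist (of_tensor (s m)) (of_tensor (s n))"
        by (simp add: dist_norm linear_diff[OF linear_of_tensor, symmetric])
      moreover have "dist (of_tensor (s m)) (X m) < e / 3" "dist (of_tensor (s n)) (X n) < e / 3"
        "dist (X m) (X n) < e / 3"
        using M N that by auto
      ultimately show ?thesis
        using dist_triangle[of "of_tensor (s m)" "of_tensor (s n)" "X m"]
          dist_triangle[of "X m" "of_tensor (s n)" "X n"]
        by (simp add: dist_commute)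
    qed
    then show "\<exists>N. \<forall>m\<ge>N. \<forall>n\<ge>N. proj_norm (s m - s n) < e" by blast
  qed
  then have lim: "(\<lambda>k. of_tensor (s k)) \<longlonglongrightarrow> abs_ptensor s"
    by (rule abs_ptensor_LIMSEQ)
  have diff: "(\<lambda>n. of_tensor (s n) - X n) \<longlonglongrightarrow> 0"
    by (rule tendsto_norm_zero_cancel) (use * in \<open>simp add: dist_norm\<close>)
  have "X \<longlonglongrightarrow> abs_ptensor s"
    using tendsto_diff[OF lim diff] by simp
  then show "convergent X"
    by (rule convergentI)
qed

definition sym_tensor :: "'a::real_vector tensor set" where
  "sym_tensor = span {x \<otimes> y + y \<otimes> x | x y. True}"

definition sym_ptensor :: "'a::real_normed_vector ptensor set" where
  "sym_ptensor = closure (of_tensor ` sym_tensor)"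


section \<open>Symmetric operators and the duality pairing\<close>

definition sym_ops :: "('a::real_normed_vector \<Rightarrow>\<^sub>L 'a \<Rightarrow>\<^sub>L real) set" where
  "sym_ops = {P :: 'a \<Rightarrow>\<^sub>L 'a \<Rightarrow>\<^sub>L real. \<forall>x y. P x y = P y x}"

definition pos_sym_ops :: "('a::real_normed_vector \<Rightarrow>\<^sub>L 'a \<Rightarrow>\<^sub>L real) set" where
  "pos_sym_ops = {P \<in> sym_ops. \<forall>x. 0 \<le> P x x}"

definition tensor_pairing ::
    "('a::real_normed_vector \<Rightarrow>\<^sub>L 'a \<Rightarrow>\<^sub>L real) \<Rightarrow> 'a tensor \<Rightarrow> real" where
  "tensor_pairing P \<rho> = (\<Sum>(x, y)\<in>#rep_tensor \<rho>. P x y)"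

lemma tensor_pairing_sum: "tensor_pairing P (\<Sum>(x, y)\<in>#m. x \<otimes> y) = (\<Sum>(x, y)\<in>#m. P x y)"
proof -
  have eq: "(\<Sum>(x, y)\<in>#m. P x y) = (\<Sum>(x, y)\<in>#n. P x y)" if "tensor_cong m n" for m n
    using that by induction (auto simp: blinfun.bilinear_simps)
  have "tensor_cong (rep_tensor (abs_tensor m)) m"
    by (rule Quotient_rep_abs[OF Quotient_tensor tensor_cong.refl])
  then show ?thesis
    unfolding tensor_pairing_def abs_tensor_eq_sum[symmetric] by (rule eq)
qed

lemma tensor_pairing_elem [simp]: "tensor_pairing P (x \<otimes> y) = P x y"
  using tensor_pairing_sum[of P "{#(x, y)#}"] by simp

lemma linear_tensor_pairing:
  fixes P :: "'a::real_normed_vector \<Rightarrow>\<^sub>L 'a \<Rightarrow>\<^sub>L real"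
  shows "linear (tensor_pairing P)"
proof (rule linearI)
  fix \<rho> \<sigma> :: "'a tensor" and c
  obtain m where m: "\<rho> = (\<Sum>(x, y)\<in>#m. x \<otimes> y)"
    using ex_tensor_representation by blast
  obtain n where n: "\<sigma> = (\<Sum>(x, y)\<in>#n. x \<otimes> y)"
    using ex_tensor_representation by blast
  show "tensor_pairing P (\<rho> + \<sigma>) = tensor_pairing P \<rho> + tensor_pairing P \<sigma>"
    using tensor_pairing_sum[of P "m + n"] by (simp add: m n tensor_pairing_sum)
  let ?S = "image_mset (\<lambda>(x, y). (c *\<^sub>R x, y)) m"
  have "c *\<^sub>R \<rho> = (\<Sum>(x, y)\<in>#?S. x \<otimes> y)"
    unfolding m by (induction m) (auto simp: scaleR_add_right bilinear_lmul[OF elem_tensor_bilinear])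
  moreover have "(\<Sum>(x, y)\<in>#?S. P x y) = c *\<^sub>R (\<Sum>(x, y)\<in>#m. P x y)"
    by (induction m) (auto simp: blinfun.bilinear_simps distrib_left)
  ultimately show "tensor_pairing P (c *\<^sub>R \<rho>) = c *\<^sub>R tensor_pairing P \<rho>"
    by (simp only: tensor_pairing_sum m)
qed

lemma abs_tensor_pairing_le: "\<bar>tensor_pairing P \<rho>\<bar> \<le> norm P * proj_norm \<rho>"
proof -
  have rep: "\<bar>tensor_pairing P (\<Sum>(x, y)\<in>#m. x \<otimes> y)\<bar> \<le> norm P * (\<Sum>(x, y)\<in>#m. norm x * norm y)" for m
  proof (induction m)
    case (add z m)
    obtain x y where z: "z = (x, y)" by fastforce
    have "\<bar>P x y\<bar> \<le> norm P * (norm x * norm y)"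
      using norm_blinfun[of "P x" y] mult_right_mono[OF norm_blinfun[of P x] norm_ge_zero[of y]]
      by (simp add: mult.assoc)
    then show ?case
      using add by (simp add: z linear_add[OF linear_tensor_pairing] distrib_left)
  qed (simp add: linear_0[OF linear_tensor_pairing])
  show ?thesis
  proof (rule field_le_epsilon)
    fix e :: real assume "e > 0"
    define d where "d = e / (norm P + 1)"
    have "d > 0" using \<open>e > 0\<close> by (simp add: d_def add_nonneg_pos)
    then obtain m where m: "\<rho> = (\<Sum>(x, y)\<in>#m. x \<otimes> y)"
      "(\<Sum>(x, y)\<in>#m. norm x * norm y) < proj_norm \<rho> + d"
      using proj_norm_approx[of \<rho> "proj_norm \<rho> + d"] by auto
    have "norm P * (\<Sum>(x, y)\<in>#m. norm x * norm y) \<le> norm P * (proj_norm \<rho> + d)"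
      using m(2) by (intro mult_left_mono) auto
    moreover have "norm P * d \<le> (norm P + 1) * d"
      using \<open>d > 0\<close> by simp
    moreover have "(norm P + 1) * d = e"
      using add_nonneg_pos[OF norm_ge_zero[of P] zero_less_one] by (simp add: d_def)
    ultimately show "\<bar>tensor_pairing P \<rho>\<bar> \<le> norm P * proj_norm \<rho> + e"
      using rep[of m] m(1) by (simp add: distrib_left)
  qed
qed

lemma tensor_pairing_Cauchy:
  assumes "proj_Cauchy s"
  shows "Cauchy (\<lambda>n. tensor_pairing P (s n))"
proof (rule metric_CauchyI)
  fix e :: real assume "e > 0"
  then have "0 < e / (norm P + 1)"
    by (simp add: add_nonneg_pos)
  then obtain N where N: "\<forall>m\<ge>N. \<forall>n\<ge>N. proj_norm (s m - s n) < e / (norm P + 1)"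
    using assms unfolding proj_Cauchy_def by blast
  have "dist (tensor_pairing P (s m)) (tensor_pairing P (s n)) < e" if "m \<ge> N" "n \<ge> N" for m n
  proof -
    have "\<bar>tensor_pairing P (s m) - tensor_pairing P (s n)\<bar> \<le> norm P * proj_norm (s m - s n)"
      using abs_tensor_pairing_le[of P "s m - s n"] by (simp add: linear_diff[OF linear_tensor_pairing])
    also have "\<dots> \<le> (norm P + 1) * proj_norm (s m - s n)"
      using proj_norm_nonneg by (intro mult_right_mono) auto
    also have "\<dots> < e"
      using N that by (simp add: pos_less_divide_eq add_nonneg_pos mult.commute)
    finally show ?thesis by (simp add: dist_real_def)
  qed
  then show "\<exists>N. \<forall>m\<ge>N. \<forall>n\<ge>N. dist (tensor_pairing P (s m)) (tensor_pairing P (s n)) < e" by blast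
qed

lemma tensor_pairing_LIMSEQ:
  "proj_Cauchy s \<Longrightarrow> (\<lambda>n. tensor_pairing P (s n)) \<longlonglongrightarrow> lim (\<lambda>n. tensor_pairing P (s n))"
  using tensor_pairing_Cauchy Cauchy_convergent convergent_LIMSEQ_iff by blast

lift_definition pairing :: "('a::real_normed_vector \<Rightarrow>\<^sub>L 'a \<Rightarrow>\<^sub>L real) \<Rightarrow> 'a ptensor \<Rightarrow> real"
  is "\<lambda>P s. lim (\<lambda>n. tensor_pairing P (s n))"
proof -
  fix P :: "'a \<Rightarrow>\<^sub>L 'a \<Rightarrow>\<^sub>L real" and s t :: "nat \<Rightarrow> 'a tensor"
  assume "proj_equiv s t"
  then have s: "proj_Cauchy s" and t: "proj_Cauchy t" and "(\<lambda>n. proj_norm (s n - t n)) \<longlonglongrightarrow> 0"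
    by (auto simp: proj_equiv_def)
  then have "(\<lambda>n. norm P * proj_norm (s n - t n)) \<longlonglongrightarrow> 0"
    using tendsto_mult_right_zero by blast
  then have "(\<lambda>n. tensor_pairing P (s n) - tensor_pairing P (t n)) \<longlonglongrightarrow> 0"
    by (rule Lim_null_comparison[rotated])
       (auto simp: linear_diff[OF linear_tensor_pairing, symmetric] abs_tensor_pairing_le)
  moreover have "(\<lambda>n. tensor_pairing P (s n) - tensor_pairing P (t n)) \<longlonglongrightarrow>
      lim (\<lambda>n. tensor_pairing P (s n)) - lim (\<lambda>n. tensor_pairing P (t n))"
    by (intro tendsto_diff tensor_pairing_LIMSEQ s t)
  ultimately show "lim (\<lambda>n. tensor_pairing P (s n)) = lim (\<lambda>n. tensor_pairing P (t n))"
    using LIMSEQ_unique by fastforce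
qed

lemma pairing_of_tensor [simp]: "pairing P (of_tensor \<rho>) = tensor_pairing P \<rho>"
  by (simp add: of_tensor_def pairing.abs_eq proj_equiv_refl)

lemma bounded_linear_pairing:
  fixes P :: "'a::real_normed_vector \<Rightarrow>\<^sub>L 'a \<Rightarrow>\<^sub>L real"
  shows "bounded_linear (pairing P)"
proof (rule bounded_linear_intro)
  show "pairing P (\<rho> + \<sigma>) = pairing P \<rho> + pairing P \<sigma>" for \<rho> \<sigma>
    by transfer
       (auto simp: proj_equiv_def linear_add[OF linear_tensor_pairing]
         intro!: limI tendsto_add tensor_pairing_LIMSEQ)
  show "pairing P (c *\<^sub>R \<rho>) = c *\<^sub>R pairing P \<rho>" for c \<rho>
    by transfer
       (auto simp: proj_equiv_def linear_scale[OF linear_tensor_pairing]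
         intro!: limI tendsto_mult tendsto_const tensor_pairing_LIMSEQ)
  show "norm (pairing P \<rho>) \<le> norm \<rho> * norm P" for \<rho>
  proof -
    obtain s where s: "proj_Cauchy s" "\<rho> = abs_ptensor s"
      by (rule ptensor_exhaust)
    have "norm (lim (\<lambda>n. tensor_pairing P (s n))) \<le> lim (\<lambda>n. proj_norm (s n)) * norm P"
    proof (rule LIMSEQ_le[OF tendsto_norm[OF tensor_pairing_LIMSEQ[OF s(1)]]
          tendsto_mult[OF proj_Cauchy_norm_LIMSEQ[OF s(1)] tendsto_const]], intro exI allI impI)
      show "norm (tensor_pairing P (s n)) \<le> proj_norm (s n) * norm P" for n
        using abs_tensor_pairing_le[of P "s n"] by (simp add: mult.commute)
    qed
    then show ?thesis
      by (simp add: s pairing.abs_eq norm_ptensor.abs_eq proj_equiv_refl)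
  qed
qed

definition pos_cone :: "'a::real_normed_vector ptensor set" where
  "pos_cone = {\<rho> \<in> sym_ptensor. \<forall>P\<in>pos_sym_ops. 0 \<le> pairing P \<rho>}"

text \<open>The initial topology on \<open>sym_ops\<close> for the functionals \<open>\<lambda>P. pairing P \<rho>\<close>, \<open>\<rho> \<in> sym_ptensor\<close>.\<close>

definition weak_star :: "('a::real_normed_vector \<Rightarrow>\<^sub>L 'a \<Rightarrow>\<^sub>L real) topology" where
  "weak_star = pullback_topology sym_ops (\<lambda>P. \<lambda>\<rho>\<in>sym_ptensor. pairing P \<rho>)
     (product_topology (\<lambda>_. euclideanreal) sym_ptensor)"

lemma topspace_weak_star [simp]: "topspace weak_star = sym_ops"
  by (auto simp: weak_star_def topspace_pullback_topology)

lemma continuous_map_weak_star_pairing: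
  assumes "\<rho> \<in> sym_ptensor"
  shows "continuous_map weak_star euclideanreal (\<lambda>P. pairing P \<rho>)"
proof -
  have "continuous_map weak_star euclideanreal ((\<lambda>f. f \<rho>) \<circ> (\<lambda>P. \<lambda>\<rho>\<in>sym_ptensor. pairing P \<rho>))"
    unfolding weak_star_def
    by (rule continuous_map_pullback[OF continuous_map_product_projection[OF assms]])
  then show ?thesis
    using assms by (simp add: o_def)
qed


section \<open>Semigroups on locally convex spaces\<close>

text \<open>A locally convex space is given by its topology, the underlying vector space being \<open>topspace\<close>.\<close>

definition locally_convex_space :: "'b::real_vector topology \<Rightarrow> bool" where
  "locally_convex_space \<tau> \<longleftrightarrow>
     subspace (topspace \<tau>) \<and>
     continuous_map (prod_topology \<tau> \<tau>) \<tau> (\<lambda>(x, y). x + y) \<and>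
     continuous_map (prod_topology euclideanreal \<tau>) \<tau> (\<lambda>(c, x). c *\<^sub>R x) \<and>
     (\<forall>U. openin \<tau> U \<and> 0 \<in> U \<longrightarrow> (\<exists>W. openin \<tau> W \<and> convex W \<and> 0 \<in> W \<and> W \<subseteq> U))"

definition continuous_seminorm :: "'b::real_vector topology \<Rightarrow> ('b \<Rightarrow> real) \<Rightarrow> bool" where
  "continuous_seminorm \<tau> p \<longleftrightarrow>
     (\<forall>x\<in>topspace \<tau>. 0 \<le> p x) \<and>
     (\<forall>x\<in>topspace \<tau>. \<forall>y\<in>topspace \<tau>. p (x + y) \<le> p x + p y) \<and>
     (\<forall>c. \<forall>x\<in>topspace \<tau>. p (c *\<^sub>R x) = \<bar>c\<bar> * p x) \<and>
     continuous_map \<tau> euclideanreal p"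

definition bounded_in :: "'b::real_vector topology \<Rightarrow> 'b set \<Rightarrow> bool" where
  "bounded_in \<tau> B \<longleftrightarrow> B \<subseteq> topspace \<tau> \<and>
     (\<forall>U. openin \<tau> U \<and> 0 \<in> U \<longrightarrow> (\<exists>r>0. \<forall>c. r \<le> \<bar>c\<bar> \<longrightarrow> B \<subseteq> (*\<^sub>R) c ` U))"

definition continuous_linear_op :: "'b::real_vector topology \<Rightarrow> ('b \<Rightarrow> 'b) \<Rightarrow> bool" where
  "continuous_linear_op \<tau> S \<longleftrightarrow>
     (\<forall>x\<in>topspace \<tau>. \<forall>y\<in>topspace \<tau>. S (x + y) = S x + S y) \<and>
     (\<forall>c. \<forall>x\<in>topspace \<tau>. S (c *\<^sub>R x) = c *\<^sub>R S x) \<and>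
     continuous_map \<tau> \<tau> S"

text \<open>In the last clause, finiteness of the suprema is automatic from continuity of the orbits; that
  they are bounded on \<open>B\<close> is expressed by a common upper bound.\<close>

definition Cb_semigroup :: "'b::real_vector topology \<Rightarrow> (real \<Rightarrow> 'b \<Rightarrow> 'b) \<Rightarrow> bool" where
  "Cb_semigroup \<tau> S \<longleftrightarrow>
     locally_convex_space \<tau> \<and>
     (\<forall>t\<ge>0. continuous_linear_op \<tau> (S t)) \<and>
     (\<forall>x\<in>topspace \<tau>. S 0 x = x) \<and>
     (\<forall>t\<ge>0. \<forall>s\<ge>0. \<forall>x\<in>topspace \<tau>. S (t + s) x = S t (S s x)) \<and>
     (\<forall>x\<in>topspace \<tau>. continuous_map (top_of_set {0..}) \<tau> (\<lambda>t. S t x)) \<and>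
     (\<forall>p a B. continuous_seminorm \<tau> p \<and> 0 < a \<and> bounded_in \<tau> B \<longrightarrow>
        (\<exists>M. \<forall>x\<in>B. \<forall>t\<in>{0..a}. p (S t x) \<le> M))"

definition C0_semigroup :: "(real \<Rightarrow> 'a::real_normed_vector \<Rightarrow>\<^sub>L 'a) \<Rightarrow> bool" where
  "C0_semigroup T \<longleftrightarrow>
     T 0 = id_blinfun \<and>
     (\<forall>t\<ge>0. \<forall>s\<ge>0. T (t + s) = T t o\<^sub>L T s) \<and>
     (\<forall>x. ((\<lambda>t. T t x) \<longlongrightarrow> x) (at_right 0))"


section \<open>Positive, compatible and Lyapunov semigroups\<close>

definition positive_semigroup ::
    "(real \<Rightarrow> ('a::real_normed_vector \<Rightarrow>\<^sub>L 'a \<Rightarrow>\<^sub>L real) \<Rightarrow> ('a \<Rightarrow>\<^sub>L 'a \<Rightarrow>\<^sub>L real)) \<Rightarrow> bool" where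
  "positive_semigroup S \<longleftrightarrow> (\<forall>t\<ge>0. S t ` pos_sym_ops \<subseteq> pos_sym_ops)"

text \<open>For weak* continuous \<open>S\<close> the functional \<open>\<lambda>P. pairing (S P) \<rho>\<close> is represented by some element of
  \<open>sym_ptensor\<close>, and by only one since \<open>sym_ops\<close> is its Banach dual, hence separates its points.\<close>

definition predual_adjoint ::
    "(('a::real_normed_vector \<Rightarrow>\<^sub>L 'a \<Rightarrow>\<^sub>L real) \<Rightarrow> ('a \<Rightarrow>\<^sub>L 'a \<Rightarrow>\<^sub>L real)) \<Rightarrow> 'a ptensor \<Rightarrow> 'a ptensor" where
  "predual_adjoint S \<rho> =
     (THE \<sigma>. \<sigma> \<in> sym_ptensor \<and> (\<forall>P\<in>sym_ops. pairing (S P) \<rho> = pairing P \<sigma>))"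

definition pi_compatible ::
    "(real \<Rightarrow> ('a::real_normed_vector \<Rightarrow>\<^sub>L 'a \<Rightarrow>\<^sub>L real) \<Rightarrow> ('a \<Rightarrow>\<^sub>L 'a \<Rightarrow>\<^sub>L real)) \<Rightarrow> bool" where
  "pi_compatible S \<longleftrightarrow> (\<forall>\<rho>\<in>pos_cone. continuous_on {0..} (\<lambda>t. norm (predual_adjoint (S t) \<rho>)))"

definition dual_op ::
    "('a::real_normed_vector \<Rightarrow>\<^sub>L 'b::real_normed_vector) \<Rightarrow> ('b \<Rightarrow>\<^sub>L real) \<Rightarrow>\<^sub>L ('a \<Rightarrow>\<^sub>L real)" where
  "dual_op A = Blinfun (\<lambda>f. f o\<^sub>L A)"

lemma dual_op_apply [simp]: "dual_op A f = f o\<^sub>L A"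
  unfolding dual_op_def
  by (simp add: bounded_linear_Blinfun_apply
      bounded_bilinear.bounded_linear_left[OF bounded_bilinear_blinfun_compose])

definition lyapunov_semigroup ::
    "(real \<Rightarrow> 'a::real_normed_vector \<Rightarrow>\<^sub>L 'a) \<Rightarrow> real \<Rightarrow>
     ('a \<Rightarrow>\<^sub>L 'a \<Rightarrow>\<^sub>L real) \<Rightarrow> ('a \<Rightarrow>\<^sub>L 'a \<Rightarrow>\<^sub>L real)" where
  "lyapunov_semigroup T t P = dual_op (T t) o\<^sub>L P o\<^sub>L T t"

lemma lyapunov_semigroup_apply: "lyapunov_semigroup T t P x y = P (T t x) (T t y)"
  by (simp add: lyapunov_semigroup_def)

end

theory Submission
  imports Defs
begin

text \<open>Every symmetric tensor is the sum of a \<open>\<pi>\<close>-convergent series of algebraic tensors. Symmetrizing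
  a term \<open>x \<otimes> y\<close>, rescaled such that \<open>\<parallel>x\<parallel> = \<parallel>y\<parallel>\<close>, and polarizing writes it as a difference of
  positive multiples of squares \<open>z \<otimes> z\<close> with norms at most \<open>\<parallel>x\<parallel> \<parallel>y\<parallel>\<close>, so that both parts of the
  series converge in the closed positive cone.

  The adjoint of the Lyapunov semigroup is \<open>T(t) \<otimes> T(t)\<close> on the completed tensor product. It is
  strongly continuous on elementary tensors and locally bounded, hence itself a \<open>C\<^sub>0\<close> semigroup, which
  yields the weak* continuity of the orbits as well as \<open>\<pi>\<close>-compatibility. The uniform bound of a
  \<open>C\<^sub>b\<close> semigroup comes from the Banach--Steinhaus theorem, as weak* bounded sets of operators are
  norm bounded. The Hahn--Banach theorem makes the adjoint unique.\<close>

section \<open>Banach--Steinhaus and Hahn--Banach\<close>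

text \<open>By the Baire category theorem one of the closed sets \<open>G n\<close>, which cover the
  complete space, has nonempty interior. A ball on which all of \<open>F\<close> is bounded then
  controls the norms.\<close>

theorem banach_steinhaus:
  fixes F :: "('a::banach \<Rightarrow>\<^sub>L 'b::real_normed_vector) set"
  assumes "\<And>x. \<exists>M. \<forall>f\<in>F. norm (f x) \<le> M"
  shows "\<exists>M. \<forall>f\<in>F. norm f \<le> M"
proof -
  define G where "G n = {x. \<forall>f\<in>F. norm (f x) \<le> real n}" for n
  have closed: "closed (G n)" for n
  proof -
    have "G n = (\<Inter>f\<in>F. {x. norm (blinfun_apply f x) \<le> real n})" by (auto simp: G_def)
    then show ?thesis
      by (auto intro!: closed_INT closed_Collect_le continuous_intros)
  qed
  have "x \<in> (\<Union>n. G n)" for x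
  proof -
    obtain M where M: "\<forall>f\<in>F. norm (f x) \<le> M" using assms by blast
    obtain n where "M \<le> real n" using real_arch_simple by blast
    with M have "x \<in> G n" by (force simp: G_def)
    then show ?thesis by blast
  qed
  then have "(\<Union>n. G n) = UNIV" by blast
  then have "euclidean interior_of (\<Union> (range G)) \<noteq> {}" by simp
  then obtain n where n: "interior (G n) \<noteq> {}"
    using Baire_category_alt[of "euclidean :: 'a topology" "range G"] closed
    by (fastforce simp: completely_metrizable_space_euclidean)
  then obtain a r where r: "r > 0" "cball a r \<subseteq> G n"
    by (metis all_not_in_conv mem_interior_cball)
  have "norm f \<le> 2 * real n / r" if "f \<in> F" for f
  proof (rule norm_blinfun_bound)
    fix x
    show "norm (f x) \<le> 2 * real n / r * norm x"
    proof (cases "x = 0")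
      case False
      define y where "y = (r / norm x) *\<^sub>R x"
      have "norm y = r" using False r by (simp add: y_def)
      then have "a + y \<in> G n" "a \<in> G n"
        using r by (auto simp: subset_iff dist_norm)
      then have "norm (f (a + y)) \<le> n" "norm (f a) \<le> n"
        using that by (auto simp: G_def)
      moreover have "norm (f y) \<le> norm (f (a + y)) + norm (f a)"
        using norm_triangle_ineq4[of "f (a + y)" "f a"] by (simp add: blinfun.bilinear_simps)
      ultimately have "norm (f y) \<le> 2 * real n" by simp
      moreover have "norm (f y) = r / norm x * norm (f x)"
        using r by (simp add: y_def blinfun.bilinear_simps)
      ultimately show ?thesis using False r by (simp add: field_simps)
    qed simp
  qed (use r in simp)
  then show ?thesis by blast
qed

section \<open>Sublinear functionals and the Hahn-Banach theorem\<close>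

definition sublinear :: "('a::real_vector \<Rightarrow> real) \<Rightarrow> bool" where
  "sublinear p \<longleftrightarrow> (\<forall>x y. p (x + y) \<le> p x + p y) \<and> (\<forall>c\<ge>0. \<forall>x. p (c *\<^sub>R x) = c * p x)"

lemma sublinear_add: "sublinear p \<Longrightarrow> p (x + y) \<le> p x + p y"
  and sublinear_scaleR: "sublinear p \<Longrightarrow> 0 \<le> c \<Longrightarrow> p (c *\<^sub>R x) = c * p x"
  by (auto simp: sublinear_def)

lemma sublinear_0: "sublinear p \<Longrightarrow> p 0 = 0"
  using sublinear_scaleR[of p 0 0] by simp

lemma sublinear_minus: "sublinear p \<Longrightarrow> - p (- x) \<le> p x"
  using sublinear_add[of p x "- x"] sublinear_0[of p] by simp

text \<open>One inequality for positive scalars is enough: applied with \<open>inverse c\<close> to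
  \<open>c *\<^sub>R x\<close> it yields the reverse one.\<close>

lemma sublinearI:
  assumes add: "\<And>x y. p (x + y) \<le> p x + p y" and zero: "p 0 = 0"
    and le: "\<And>c x. c > 0 \<Longrightarrow> p (c *\<^sub>R x) \<le> c * p x"
  shows "sublinear p"
  unfolding sublinear_def
proof (intro conjI allI impI add)
  fix c :: real and x assume "0 \<le> c"
  show "p (c *\<^sub>R x) = c * p x"
  proof (cases "c = 0")
    case False
    with \<open>0 \<le> c\<close> have c: "c > 0" by simp
    have "p x \<le> inverse c * p (c *\<^sub>R x)"
      using le[of "inverse c" "c *\<^sub>R x"] c by simp
    then have "c * p x \<le> p (c *\<^sub>R x)"
      using c by (simp add: field_simps)
    with le[OF c, of x] show ?thesis by simp
  qed (simp add: zero)
qed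

lemma sublinear_norm: "sublinear norm"
  by (rule sublinearI) (auto simp: norm_triangle_ineq)

text \<open>The infimum in \<open>q\<close> lowers \<open>p\<close> along the direction
  \<open>y\<close>; it is finite because \<open>- p (- x)\<close> bounds it from below. The gain at
  \<open>- y\<close> serves twice: it makes minimal sublinear functionals odd, and it makes a
  functional below the norm attain the norm at a given point.\<close>

lemma sublinear_reduce:
  assumes p: "sublinear p"
  obtains q where "sublinear q" "q \<le> p" "q (- y) \<le> - p y"
proof
  define q where "q x = (INF t\<in>{0..}. p (x + t *\<^sub>R y) - t * p y)" for x
  have lower: "- p (- x) \<le> p (x + t *\<^sub>R y) - t * p y" if "t \<ge> 0" for x t
    using sublinear_add[OF p, of "x + t *\<^sub>R y" "- x"] sublinear_scaleR[OF p that, of y] by simp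
  then have bdd: "bdd_below ((\<lambda>t. p (x + t *\<^sub>R y) - t * p y) ` {0..})" for x
    by (meson atLeast_iff bdd_belowI2)
  have le: "q x \<le> p (x + t *\<^sub>R y) - t * p y" if "t \<ge> 0" for x t
    unfolding q_def using that by (intro cINF_lower bdd) auto
  have ge: "c \<le> q x" if "\<And>t. t \<ge> 0 \<Longrightarrow> c \<le> p (x + t *\<^sub>R y) - t * p y" for c x
    unfolding q_def using that by (intro cINF_greatest) auto
  show "q \<le> p"
    using le[of 0] by (simp add: le_fun_def)
  \<comment> \<open>At \<open>t = 1\<close> the argument \<open>- y + t *\<^sub>R y\<close>
    vanishes, leaving \<open>p 0 - p y\<close>.\<close>
  show "q (- y) \<le> - p y"
    using le[of 1 "- y"] sublinear_0[OF p] by simp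
  show "sublinear q"
  proof (rule sublinearI)
    fix x x'
    \<comment> \<open>Each argument has its own parameter, and \<open>s + t\<close> is admissible
      for the sum. The two infima are then taken one after the other.\<close>
    have "q (x + x') \<le> (p (x + s *\<^sub>R y) - s * p y) + (p (x' + t *\<^sub>R y) - t * p y)"
      if "s \<ge> 0" "t \<ge> 0" for s t
      using le[of "s + t" "x + x'"] sublinear_add[OF p, of "x + s *\<^sub>R y" "x' + t *\<^sub>R y"] that
      by (simp add: algebra_simps)
    then have "q (x + x') - (p (x' + t *\<^sub>R y) - t * p y) \<le> q x" if "t \<ge> 0" for t
      using that by (intro ge) (simp add: algebra_simps)
    then have "q (x + x') - q x \<le> q x'"
      by (intro ge) (simp add: algebra_simps)
    then show "q (x + x') \<le> q x + q x'" by simp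
  next
    show "q 0 = 0"
      using \<open>q \<le> p\<close> sublinear_0[OF p] ge[of 0 0] lower[of _ 0]
      by (intro antisym) (auto simp: le_fun_def dest: spec[of _ 0])
  next
    fix c :: real and x assume c: "c > 0"
    have "q (c *\<^sub>R x) / c \<le> q x"
    proof (rule ge)
      fix t :: real assume "t \<ge> 0"
      \<comment> \<open>The parameter \<open>t\<close> for \<open>x\<close> corresponds to
        \<open>c * t\<close> for \<open>c *\<^sub>R x\<close>.\<close>
      then have "q (c *\<^sub>R x) \<le> p (c *\<^sub>R (x + t *\<^sub>R y)) - c * t * p y"
        using le[of "c * t" "c *\<^sub>R x"] c by (simp add: scaleR_add_right)
      also have "\<dots> = c * (p (x + t *\<^sub>R y) - t * p y)"
        using sublinear_scaleR[OF p, of c "x + t *\<^sub>R y"] c by (simp add: algebra_simps)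
      finally show "q (c *\<^sub>R x) / c \<le> p (x + t *\<^sub>R y) - t * p y"
        using c by (simp add: pos_divide_le_eq mult.commute)
    qed
    then show "q (c *\<^sub>R x) \<le> c * q x"
      using c by (simp add: field_simps)
  qed
qed

text \<open>The pointwise infimum provides the lower bound for Zorn's lemma. It is finite since all
  members share the bound \<open>- p (- x)\<close>. Subadditivity, which fails for infima in
  general, comes from the chain: of two members the smaller one serves both arguments.\<close>

lemma sublinear_INF_chain:
  fixes C :: "('a::real_vector \<Rightarrow> real) set"
  assumes C: "C \<noteq> {}" "\<And>q. q \<in> C \<Longrightarrow> sublinear q \<and> q \<le> p"
    and chain: "\<And>q r. q \<in> C \<Longrightarrow> r \<in> C \<Longrightarrow> q \<le> r \<or> r \<le> q"
  obtains u where "sublinear u" "\<And>q. q \<in> C \<Longrightarrow> u \<le> q"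
proof
  define u where "u x = (INF q\<in>C. q x)" for x
  have "- p (- x) \<le> q x" if "q \<in> C" for q x
    using C(2)[OF that] sublinear_minus[of q x] by (force simp: le_fun_def dest: spec[of _ "- x"])
  then have bdd: "bdd_below ((\<lambda>q. q x) ` C)" for x
    by (rule bdd_belowI2)
  have le: "u x \<le> q x" if "q \<in> C" for q x
    unfolding u_def by (rule cINF_lower[OF bdd that])
  have ge: "c \<le> u x" if "\<And>q. q \<in> C \<Longrightarrow> c \<le> q x" for c x
    unfolding u_def using that C(1) by (intro cINF_greatest) auto
  show "u \<le> q" if "q \<in> C" for q
    using le[OF that] by (simp add: le_fun_def)
  show "sublinear u"
  proof (rule sublinearI)
    fix x y
    have "u (x + y) \<le> q x + r y" if qr: "q \<in> C" "r \<in> C" for q r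
    proof -
      obtain s where s: "s \<in> C" "s \<le> q" "s \<le> r"
        using chain[OF qr] qr by blast
      then have "u (x + y) \<le> s x + s y"
        using le[of s "x + y"] sublinear_add[of s x y] C(2) by fastforce
      with s show ?thesis by (smt (verit) le_funD)
    qed
    then have "u (x + y) - r y \<le> u x" if "r \<in> C" for r
      using that by (intro ge) (simp add: algebra_simps)
    then have "u (x + y) - u x \<le> u y"
      by (intro ge) (simp add: algebra_simps)
    then show "u (x + y) \<le> u x + u y" by simp
  next
    have "q 0 = 0" if "q \<in> C" for q using C(2)[OF that] sublinear_0 by blast
    then have "(\<lambda>q. q 0) ` C = {0}" using C(1) by force
    then show "u 0 = 0" by (simp add: u_def)
  next
    fix c :: real and x assume c: "c > 0"
    have "u (c *\<^sub>R x) / c \<le> u x"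
    proof (rule ge)
      fix q assume "q \<in> C"
      then show "u (c *\<^sub>R x) / c \<le> q x"
        using le[of q "c *\<^sub>R x"] sublinear_scaleR[of q c x] C(2)[of q] c
        by (simp add: pos_divide_le_eq mult.commute)
    qed
    then show "u (c *\<^sub>R x) \<le> c * u x"
      using c by (simp add: field_simps)
  qed
qed

text \<open>A minimal sublinear functional \<open>m\<close> is linear: reducing it along \<open>y\<close> changes nothing, whence
  \<open>m (- y) \<le> - m y\<close>.\<close>

lemma sublinear_dominates_linear:
  assumes p: "sublinear p"
  obtains f where "linear f" "f \<le> p"
proof -
  let ?A = "{q. sublinear q \<and> q \<le> p}"
  have "\<exists>m\<in>?A. \<forall>a\<in>?A. a \<le> m \<longrightarrow> a = m"
  \<comment> \<open>The order is reversed, so that Zorn's lemma yields a minimal element.\<close>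
  proof (rule predicate_Zorn[of ?A "\<lambda>x y. y \<le> x"])
    show "partial_order_on ?A (relation_of (\<lambda>x y. y \<le> x) ?A)"
      by (rule partial_order_on_relation_ofI) auto
  next
    fix C assume C: "C \<in> Chains (relation_of (\<lambda>x y. y \<le> x) ?A)"
    then have sub: "q \<in> C \<Longrightarrow> sublinear q \<and> q \<le> p" for q
      by (auto simp: Chains_def relation_of_def)
    have chain: "q \<in> C \<Longrightarrow> r \<in> C \<Longrightarrow> q \<le> r \<or> r \<le> q" for q r
      using C by (auto simp: Chains_def relation_of_def)
    show "\<exists>u\<in>?A. \<forall>a\<in>C. u \<le> a"
    proof (cases "C = {}")
      \<comment> \<open>The empty chain is bounded below by \<open>p\<close> itself.\<close>
      case True
      with p show ?thesis by auto
    next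
      case False
      obtain u where "sublinear u" "\<And>q. q \<in> C \<Longrightarrow> u \<le> q"
        using sublinear_INF_chain[OF False sub chain] by blast
      with False sub show ?thesis by (metis (mono_tags) equals0I mem_Collect_eq order_trans)
    qed
  qed
  then obtain m where m: "sublinear m" "m \<le> p"
    and min: "\<And>q. sublinear q \<Longrightarrow> q \<le> m \<Longrightarrow> q = m"
    by (metis (mono_tags, lifting) mem_Collect_eq order_trans)
  have neg: "m (- y) = - m y" for y
  proof -
    obtain q where "sublinear q" "q \<le> m" "q (- y) \<le> - m y"
      using sublinear_reduce[OF m(1)] by blast
    then have "m (- y) \<le> - m y" using min by blast
    with sublinear_minus[OF m(1), of y] show ?thesis by simp
  qed
  have "linear m"
  proof (rule linearI)
    \<comment> \<open>By \<open>neg\<close>, subadditivity at \<open>- x\<close> and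
      \<open>- y\<close> is the reverse inequality at \<open>x\<close> and \<open>y\<close>.\<close>
    show "m (x + y) = m x + m y" for x y
      using sublinear_add[OF m(1), of x y] sublinear_add[OF m(1), of "- x" "- y"] neg[of "x + y"]
      by (simp add: neg)
    show "m (c *\<^sub>R x) = c *\<^sub>R m x" for c x
    proof (cases "c \<ge> 0")
      case True
      then show ?thesis by (simp add: sublinear_scaleR[OF m(1)])
    next
      case False
      then show ?thesis
        using sublinear_scaleR[OF m(1), of "- c" x] neg[of "c *\<^sub>R x"] by simp
    qed
  qed
  with m(2) that show ?thesis by blast
qed

text \<open>Reducing the norm along \<open>x\<close> first forces every linear functional below the
  result to take a value of at most \<open>- norm x\<close> at \<open>- x\<close>. This takes the
  place of extending a functional from the line through \<open>x\<close>.\<close>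

theorem norming_functional:
  fixes x :: "'a::real_normed_vector"
  obtains f :: "'a \<Rightarrow>\<^sub>L real" where "f x = norm x" "norm f \<le> 1"
proof -
  obtain q :: "'a \<Rightarrow> real" where q: "sublinear q" "q \<le> norm" "q (- x) \<le> - norm x"
    using sublinear_reduce[OF sublinear_norm] by blast
  obtain g where g: "linear g" "g \<le> q"
    using sublinear_dominates_linear[OF q(1)] by blast
  have le: "g y \<le> norm y" for y
    using g(2) q(2) by (meson le_fun_def order_trans)
  then have abs: "norm (g y) \<le> norm y * 1" for y
    using le[of y] le[of "- y"] by (simp add: linear_neg[OF g(1)] abs_le_iff)
  have bl: "bounded_linear g"
    by (rule bounded_linear_intro[OF linear_add[OF g(1)] linear_scale[OF g(1)] abs])
  have "g (- x) \<le> - norm x"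
    using g(2) q(3) by (meson le_fun_def order_trans)
  then have "g x = norm x"
    using le[of x] by (simp add: linear_neg[OF g(1)])
  moreover have "norm (Blinfun g) \<le> 1"
    using abs by (intro norm_blinfun_bound) (auto simp: bounded_linear_Blinfun_apply[OF bl])
  ultimately show ?thesis
    using that[of "Blinfun g"] by (simp add: bounded_linear_Blinfun_apply[OF bl])
qed

section \<open>Bilinear maps on the projective tensor product\<close>

text \<open>The sum runs over a chosen representative; for bilinear \<open>f\<close> the value is
  independent of the choice.\<close>

definition tensor_lift :: "('a::real_vector \<Rightarrow> 'a \<Rightarrow> 'b::real_vector) \<Rightarrow> 'a tensor \<Rightarrow> 'b" where
  "tensor_lift f \<rho> = (\<Sum>(x, y)\<in>#rep_tensor \<rho>. f x y)"

text \<open>Bilinearity makes the sum invariant under every generator of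
  \<open>tensor_cong\<close>.\<close>

lemma tensor_lift_sum:
  assumes f: "bilinear f"
  shows "tensor_lift f (\<Sum>(x, y)\<in>#m. x \<otimes> y) = (\<Sum>(x, y)\<in>#m. f x y)"
proof -
  have eq: "(\<Sum>(x, y)\<in>#m. f x y) = (\<Sum>(x, y)\<in>#n. f x y)" if "tensor_cong m n" for m n
    using that
    by induction (auto simp: bilinear_ladd[OF f] bilinear_radd[OF f] bilinear_lmul[OF f]
        bilinear_rmul[OF f] bilinear_lzero[OF f])
  have "tensor_cong (rep_tensor (abs_tensor m)) m"
    by (rule Quotient_rep_abs[OF Quotient_tensor tensor_cong.refl])
  then show ?thesis
    unfolding tensor_lift_def abs_tensor_eq_sum[symmetric] by (rule eq)
qed

lemma tensor_lift_elem: "bilinear f \<Longrightarrow> tensor_lift f (x \<otimes> y) = f x y"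
  using tensor_lift_sum[of f "{#(x, y)#}"] by simp

lemma linear_tensor_lift:
  assumes f: "bilinear f"
  shows "linear (tensor_lift f)"
proof (rule linearI)
  fix \<rho> \<sigma> :: "'a tensor" and c
  obtain m n where m: "\<rho> = (\<Sum>(x, y)\<in>#m. x \<otimes> y)" and n: "\<sigma> = (\<Sum>(x, y)\<in>#n. x \<otimes> y)"
    using ex_tensor_representation by metis
  show "tensor_lift f (\<rho> + \<sigma>) = tensor_lift f \<rho> + tensor_lift f \<sigma>"
    using tensor_lift_sum[OF f, of "m + n"] by (simp add: m n tensor_lift_sum[OF f])
  let ?S = "image_mset (\<lambda>(x, y). (c *\<^sub>R x, y)) m"
  have "c *\<^sub>R \<rho> = (\<Sum>(x, y)\<in>#?S. x \<otimes> y)"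
    unfolding m by (induction m) (auto simp: scaleR_add_right bilinear_lmul[OF elem_tensor_bilinear])
  moreover have "(\<Sum>(x, y)\<in>#?S. f x y) = c *\<^sub>R (\<Sum>(x, y)\<in>#m. f x y)"
    by (induction m) (auto simp: bilinear_lmul[OF f] scaleR_add_right)
  ultimately show "tensor_lift f (c *\<^sub>R \<rho>) = c *\<^sub>R tensor_lift f \<rho>"
    by (simp only: tensor_lift_sum[OF f] m)
qed

text \<open>The infimum defining \<open>proj_norm\<close> need not be attained, so the termwise
  estimate is applied to a representation that is optimal up to \<open>d\<close>.\<close>

lemma norm_tensor_lift_le:
  assumes f: "bilinear f" and le: "\<And>x y. norm (f x y) \<le> K * (norm x * norm y)" and K: "0 \<le> K"
  shows "norm (tensor_lift f \<rho>) \<le> K * proj_norm \<rho>"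
proof (rule field_le_epsilon)
  fix e :: real assume "e > 0"
  \<comment> \<open>Dividing by \<open>K + 1\<close> instead of \<open>K\<close> covers
    \<open>K = 0\<close>.\<close>
  define d where "d = e / (K + 1)"
  have d: "d > 0" "K * d \<le> e"
    using \<open>e > 0\<close> K by (auto simp: d_def field_simps)
  then obtain m where m: "\<rho> = (\<Sum>(x, y)\<in>#m. x \<otimes> y)"
    "(\<Sum>(x, y)\<in>#m. norm x * norm y) < proj_norm \<rho> + d"
    using proj_norm_approx[of \<rho> "proj_norm \<rho> + d"] by auto
  have "norm (\<Sum>(x, y)\<in>#m. f x y) \<le> K * (\<Sum>(x, y)\<in>#m. norm x * norm y)" for m
  proof (induction m)
    case (add z m)
    then show ?case
      using le[of "fst z" "snd z"]
      by (cases z) (auto simp: distrib_left intro: norm_triangle_mono)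
  qed simp
  then have "norm (tensor_lift f \<rho>) \<le> K * (\<Sum>(x, y)\<in>#m. norm x * norm y)"
    by (simp add: m(1) tensor_lift_sum[OF f])
  also have "\<dots> \<le> K * (proj_norm \<rho> + d)"
    using m(2) K by (intro mult_left_mono) auto
  finally show "norm (tensor_lift f \<rho>) \<le> K * proj_norm \<rho> + e"
    using d(2) by (simp add: distrib_left)
qed

lemma ptensor_approx:
  obtains s where "(\<lambda>n. of_tensor (s n)) \<longlonglongrightarrow> \<rho>"
  using ptensor_exhaust[of \<rho>] abs_ptensor_LIMSEQ by metis

lemma ptensor_closed_induct:
  assumes "closed {\<rho>. Q \<rho>}" "\<And>\<tau>. Q (of_tensor \<tau>)"
  shows "Q \<rho>"
proof -
  have "closure (range of_tensor) \<subseteq> {\<rho>. Q \<rho>}"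
    using assms by (intro closure_minimal) auto
  then show ?thesis by (auto simp: closure_range_of_tensor)
qed

text \<open>Scalars can be absorbed into a factor, so every tensor is a finite sum of elementary
  ones; the empty sum is \<open>0 \<otimes> 0\<close>.\<close>

lemma tensor_induct [case_names add elem]:
  assumes "\<And>\<rho> \<sigma>. Q \<rho> \<Longrightarrow> Q \<sigma> \<Longrightarrow> Q (\<rho> + \<sigma>)" "\<And>x y. Q (x \<otimes> y)"
  shows "Q \<rho>"
proof -
  obtain m where m: "\<rho> = (\<Sum>(x, y)\<in>#m. x \<otimes> y)"
    using ex_tensor_representation by blast
  have "Q 0"
    using assms(2)[of 0 0] by (simp add: bilinear_lzero[OF elem_tensor_bilinear])
  then have "Q (\<Sum>(x, y)\<in>#m. x \<otimes> y)"
    by (induction m) (auto intro: assms)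
  then show ?thesis by (simp add: m)
qed

lemma ptensor_bounded_linear_eqI:
  assumes f: "bounded_linear f" and g: "bounded_linear g"
    and eq: "\<And>x y. f (of_tensor (x \<otimes> y)) = g (of_tensor (x \<otimes> y))"
  shows "f \<rho> = g \<rho>"
proof (induction \<rho> rule: ptensor_closed_induct)
  show "closed {\<rho>. f \<rho> = g \<rho>}"
    by (intro closed_Collect_eq linear_continuous_on f g)
  show "f (of_tensor \<tau>) = g (of_tensor \<tau>)" for \<tau>
    by (induction \<tau> rule: tensor_induct)
       (auto simp: eq linear_add[OF linear_of_tensor] linear_add[OF bounded_linear.linear[OF f]]
         linear_add[OF bounded_linear.linear[OF g]])
qed

text \<open>The universal property of the completed projective tensor product:
  \<open>tensor_lift f\<close> is Lipschitz for the projective norm and therefore extends to the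
  completion, with the same bound.\<close>

proposition ex_ptensor_lift:
  fixes f :: "'a::real_normed_vector \<Rightarrow> 'a \<Rightarrow> 'b::banach"
  assumes f: "bilinear f" and le: "\<And>x y. norm (f x y) \<le> K * (norm x * norm y)" and K: "0 \<le> K"
  obtains L :: "'a ptensor \<Rightarrow>\<^sub>L 'b"
  where "\<And>x y. L (of_tensor (x \<otimes> y)) = f x y" "norm L \<le> K"
proof -
  let ?f = "tensor_lift f"
  note lin = linear_tensor_lift[OF f]
  have bound: "norm (?f \<sigma> - ?f \<tau>) \<le> K * norm (of_tensor \<sigma> - of_tensor \<tau>)" for \<sigma> \<tau>
    using norm_tensor_lift_le[OF f le K, of "\<sigma> - \<tau>"]
    by (simp add: linear_diff[OF lin] flip: linear_diff[OF linear_of_tensor])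
  \<comment> \<open>The limit is the same for all sequences approximating \<open>\<rho>\<close>,
    because the images of two of them differ by a null sequence. Thus choosing \<open>l\<close> for
    each \<open>\<rho>\<close> yields a map \<open>L\<close> that may be evaluated along any
    approximation.\<close>
  have ex: "\<exists>l. \<forall>s. (\<lambda>n. of_tensor (s n)) \<longlonglongrightarrow> \<rho> \<longrightarrow> (\<lambda>n. ?f (s n)) \<longlonglongrightarrow> l" for \<rho>
  proof -
    obtain s where s: "(\<lambda>n. of_tensor (s n)) \<longlonglongrightarrow> \<rho>" by (rule ptensor_approx)
    have "Cauchy (\<lambda>n. ?f (s n))"
    proof (rule metric_CauchyI)
      fix e :: real assume "e > 0"
      then have "e / (K + 1) > 0" using K by simp
      then obtain N where N: "\<And>m n. m \<ge> N \<Longrightarrow> n \<ge> N \<Longrightarrow>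
          norm (of_tensor (s m) - of_tensor (s n)) < e / (K + 1)"
        using metric_CauchyD[OF LIMSEQ_imp_Cauchy[OF s]] unfolding dist_norm by blast
      have "dist (?f (s m)) (?f (s n)) < e" if "m \<ge> N" "n \<ge> N" for m n
      proof -
        have "dist (?f (s m)) (?f (s n)) \<le> (K + 1) * norm (of_tensor (s m) - of_tensor (s n))"
          using bound[of "s m" "s n"] by (simp add: dist_norm distrib_right add_increasing2)
        also have "\<dots> < e"
          using N[OF that] K by (simp add: pos_less_divide_eq mult.commute)
        finally show ?thesis .
      qed
      then show "\<exists>N. \<forall>m\<ge>N. \<forall>n\<ge>N. dist (?f (s m)) (?f (s n)) < e" by blast
    qed
    then obtain l where l: "(\<lambda>n. ?f (s n)) \<longlonglongrightarrow> l"
      using Cauchy_convergent convergent_def by blast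
    have "(\<lambda>n. ?f (r n)) \<longlonglongrightarrow> l" if r: "(\<lambda>n. of_tensor (r n)) \<longlonglongrightarrow> \<rho>" for r
    proof -
      have "(\<lambda>n. K * norm (of_tensor (r n) - of_tensor (s n))) \<longlonglongrightarrow> 0"
        using tendsto_diff[OF r s] by (intro tendsto_mult_right_zero tendsto_norm_zero) simp
      then have "(\<lambda>n. ?f (r n) - ?f (s n)) \<longlonglongrightarrow> 0"
        by (rule Lim_null_comparison[rotated]) (simp add: bound)
      from tendsto_add[OF this l] show ?thesis by simp
    qed
    then show ?thesis by blast
  qed
  then obtain L where L: "\<And>\<rho> s. (\<lambda>n. of_tensor (s n)) \<longlonglongrightarrow> \<rho> \<Longrightarrow> (\<lambda>n. ?f (s n)) \<longlonglongrightarrow> L \<rho>"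
    by metis
  have add: "L (\<rho> + \<sigma>) = L \<rho> + L \<sigma>" for \<rho> \<sigma>
  proof -
    obtain s where s: "(\<lambda>n. of_tensor (s n)) \<longlonglongrightarrow> \<rho>" by (rule ptensor_approx)
    obtain r where r: "(\<lambda>n. of_tensor (r n)) \<longlonglongrightarrow> \<sigma>" by (rule ptensor_approx)
    have "(\<lambda>n. ?f (s n + r n)) \<longlonglongrightarrow> L (\<rho> + \<sigma>)"
      using tendsto_add[OF s r] by (intro L) (simp add: linear_add[OF linear_of_tensor])
    moreover have "(\<lambda>n. ?f (s n + r n)) \<longlonglongrightarrow> L \<rho> + L \<sigma>"
      using tendsto_add[OF L[OF s] L[OF r]] by (simp add: linear_add[OF lin])
    ultimately show ?thesis by (rule LIMSEQ_unique)
  qed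
  have scale: "L (c *\<^sub>R \<rho>) = c *\<^sub>R L \<rho>" for c \<rho>
  proof -
    obtain s where s: "(\<lambda>n. of_tensor (s n)) \<longlonglongrightarrow> \<rho>" by (rule ptensor_approx)
    have "(\<lambda>n. ?f (c *\<^sub>R s n)) \<longlonglongrightarrow> L (c *\<^sub>R \<rho>)"
      using tendsto_scaleR[OF tendsto_const s]
      by (intro L) (simp add: linear_scale[OF linear_of_tensor])
    moreover have "(\<lambda>n. ?f (c *\<^sub>R s n)) \<longlonglongrightarrow> c *\<^sub>R L \<rho>"
      using tendsto_scaleR[OF tendsto_const L[OF s]] by (simp add: linear_scale[OF lin])
    ultimately show ?thesis by (rule LIMSEQ_unique)
  qed
  have norm: "norm (L \<rho>) \<le> norm \<rho> * K" for \<rho>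
  proof -
    obtain s where s: "(\<lambda>n. of_tensor (s n)) \<longlonglongrightarrow> \<rho>" by (rule ptensor_approx)
    have "norm (?f (s n)) \<le> norm (of_tensor (s n)) * K" for n
      using norm_tensor_lift_le[OF f le K, of "s n"] by (simp add: mult.commute)
    then show ?thesis
      by (intro LIMSEQ_le[OF tendsto_norm[OF L[OF s]] tendsto_mult[OF tendsto_norm[OF s] tendsto_const]])
         blast
  qed
  have bl: "bounded_linear L"
    by (rule bounded_linear_intro[OF add scale norm])
  show ?thesis
  proof
    \<comment> \<open>An algebraic tensor is approximated by its constant sequence.\<close>
    show "Blinfun L (of_tensor (x \<otimes> y)) = f x y" for x y
      using LIMSEQ_unique[OF L[OF tendsto_const] tendsto_const]
      by (simp add: bounded_linear_Blinfun_apply[OF bl] tensor_lift_elem[OF f])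
    show "norm (Blinfun L) \<le> K"
      using norm K by (intro norm_blinfun_bound) (auto simp: bounded_linear_Blinfun_apply[OF bl] mult.commute)
  qed
qed

lemma norm_of_tensor_elem_le: "norm (of_tensor (x \<otimes> y)) \<le> norm x * norm y"
  using proj_norm_le[of "{#(x, y)#}"] by simp

lemma bilinear_of_tensor_elem: "bilinear (\<lambda>x y. of_tensor (x \<otimes> y))"
  unfolding bilinear_def
  by (auto intro!: linearI simp: bilinear_ladd[OF elem_tensor_bilinear] bilinear_radd[OF elem_tensor_bilinear]
      bilinear_lmul[OF elem_tensor_bilinear] bilinear_rmul[OF elem_tensor_bilinear]
      linear_add[OF linear_of_tensor] linear_scale[OF linear_of_tensor])

lemma bounded_bilinear_of_tensor_elem: "bounded_bilinear (\<lambda>x y. of_tensor (x \<otimes> y))"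
proof
  show "\<exists>K. \<forall>x y. norm (of_tensor (x \<otimes> y)) \<le> norm x * norm y * K"
    by (rule exI[of _ 1]) (simp add: norm_of_tensor_elem_le del: norm_of_tensor)
qed (use bilinear_of_tensor_elem in \<open>auto dest: bilinear_ladd bilinear_radd bilinear_lmul bilinear_rmul\<close>)

section \<open>The operators \<open>A \<otimes> A\<close> on the completion\<close>

lemma ex_ptensor_map:
  fixes A :: "'a::real_normed_vector \<Rightarrow>\<^sub>L 'a"
  shows "\<exists>L :: 'a ptensor \<Rightarrow>\<^sub>L 'a ptensor.
    (\<forall>x y. blinfun_apply L (of_tensor (x \<otimes> y)) = of_tensor (A x \<otimes> A y)) \<and> norm L \<le> norm A * norm A"
proof (rule ex_ptensor_lift[of "\<lambda>x y. of_tensor (A x \<otimes> A y)" "norm A * norm A"])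
  have "linear (blinfun_apply A)" by (intro bounded_linear.linear blinfun.bounded_linear_right)
  then show "bilinear (\<lambda>x y. of_tensor (A x \<otimes> A y))"
    using bilinear_of_tensor_elem
    by (auto simp: bilinear_def intro: linear_compose[unfolded o_def])
  show "norm (of_tensor (A x \<otimes> A y)) \<le> norm A * norm A * (norm x * norm y)" for x y
  proof -
    have "norm (of_tensor (A x \<otimes> A y)) \<le> norm (A x) * norm (A y)"
      by (rule norm_of_tensor_elem_le)
    also have "\<dots> \<le> (norm A * norm x) * (norm A * norm y)"
      by (intro mult_mono norm_blinfun) auto
    finally show ?thesis by (simp add: mult_ac)
  qed
qed auto

text \<open>This is \<open>A \<otimes> A\<close>, extended continuously. The values on elementary
  tensors already determine it; the norm bound is part of the choice so that both properties can be
  read off from it.\<close>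

definition ptensor_map :: "('a::real_normed_vector \<Rightarrow>\<^sub>L 'a) \<Rightarrow> 'a ptensor \<Rightarrow>\<^sub>L 'a ptensor" where
  "ptensor_map A = (SOME L. (\<forall>x y. blinfun_apply L (of_tensor (x \<otimes> y)) = of_tensor (A x \<otimes> A y)) \<and>
     norm L \<le> norm A * norm A)"

lemma ptensor_map_elem [simp]: "ptensor_map A (of_tensor (x \<otimes> y)) = of_tensor (A x \<otimes> A y)"
  and norm_ptensor_map_le: "norm (ptensor_map A) \<le> norm A * norm A"
  using someI_ex[OF ex_ptensor_map[of A]] by (auto simp: ptensor_map_def)

lemma blinfun_ptensor_eqI:
  fixes F G :: "'a::real_normed_vector ptensor \<Rightarrow>\<^sub>L 'b::real_normed_vector"
  assumes "\<And>x y. F (of_tensor (x \<otimes> y)) = G (of_tensor (x \<otimes> y))"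
  shows "F = G"
  by (rule blinfun_eqI, rule ptensor_bounded_linear_eqI[OF blinfun.bounded_linear_right
        blinfun.bounded_linear_right assms])

lemma ptensor_map_id: "ptensor_map id_blinfun = id_blinfun"
  by (rule blinfun_ptensor_eqI) simp

lemma ptensor_map_compose: "ptensor_map (A o\<^sub>L B) = ptensor_map A o\<^sub>L ptensor_map B"
  by (rule blinfun_ptensor_eqI) simp

text \<open>Both sides are continuous and linear in \<open>\<rho>\<close> and agree on elementary
  tensors. In other words, \<open>A \<otimes> A\<close> is the preadjoint of the map taking
  \<open>P\<close> to \<open>A\<^sup>* P A\<close>.\<close>

lemma pairing_ptensor_map:
  fixes P Q :: "'a::real_normed_vector \<Rightarrow>\<^sub>L 'a \<Rightarrow>\<^sub>L real" and A :: "'a \<Rightarrow>\<^sub>L 'a"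
  assumes "\<And>x y. Q x y = P (A x) (A y)"
  shows "pairing Q \<rho> = pairing P (ptensor_map A \<rho>)"
  by (rule ptensor_bounded_linear_eqI[where f = "pairing Q" and g = "\<lambda>\<rho>. pairing P (ptensor_map A \<rho>)"])
     (auto simp: assms intro: bounded_linear_pairing bounded_linear_compose[OF bounded_linear_pairing]
       blinfun.bounded_linear_right)

lemma abs_pairing_le: "\<bar>pairing P \<rho>\<bar> \<le> norm P * norm \<rho>"
proof (induction \<rho> rule: ptensor_closed_induct)
  show "closed {\<rho>. \<bar>pairing P \<rho>\<bar> \<le> norm P * norm \<rho>}"
    by (intro closed_Collect_le continuous_intros linear_continuous_on bounded_linear_pairing)
qed (simp add: abs_tensor_pairing_le)

lemma bounded_linear_pairing_left: "bounded_linear (\<lambda>P. pairing P \<rho>)"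
proof (rule bounded_linear_intro)
  fix P Q :: "'a \<Rightarrow>\<^sub>L 'a \<Rightarrow>\<^sub>L real" and c
  show "pairing (P + Q) \<rho> = pairing P \<rho> + pairing Q \<rho>"
    by (rule ptensor_bounded_linear_eqI[where g = "\<lambda>\<rho>. pairing P \<rho> + pairing Q \<rho>"])
       (auto simp: blinfun.bilinear_simps intro: bounded_linear_pairing bounded_linear_add)
  show "pairing (c *\<^sub>R P) \<rho> = c *\<^sub>R pairing P \<rho>"
    by (rule ptensor_bounded_linear_eqI[where g = "\<lambda>\<rho>. c *\<^sub>R pairing P \<rho>"])
       (auto simp: blinfun.bilinear_simps
         intro: bounded_linear_pairing bounded_linear_const_mult)
  show "norm (pairing P \<rho>) \<le> norm P * norm \<rho>"
    using abs_pairing_le by simp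
qed

section \<open>Strongly continuous semigroups\<close>

text \<open>If the norms were unbounded near 0, there would be times \<open>r n\<close> tending to 0
  with \<open>norm (T (r n)) > n\<close>, although each \<open>T (r n) x\<close> converges; this
  contradicts the Banach-Steinhaus theorem. The semigroup law then carries the bound on a short
  interval to every bounded one.\<close>

lemma C0_semigroup_locally_bounded:
  fixes T :: "real \<Rightarrow> 'a::banach \<Rightarrow>\<^sub>L 'a"
  assumes T: "C0_semigroup T"
  shows "\<exists>M. \<forall>t\<in>{0..a}. norm (T t) \<le> M"
proof -
  have T0: "T 0 = id_blinfun" and add: "\<And>s t. 0 \<le> s \<Longrightarrow> 0 \<le> t \<Longrightarrow> T (t + s) = T t o\<^sub>L T s"
    and lim: "\<And>x. ((\<lambda>t. T t x) \<longlongrightarrow> x) (at_right 0)"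
    using T by (auto simp: C0_semigroup_def)
  have "\<exists>d>0. \<exists>M. \<forall>t\<in>{0<..d}. norm (T t) \<le> M"
  proof (rule ccontr)
    assume unbounded: "\<not> ?thesis"
    have "\<exists>t. 0 < t \<and> t \<le> inverse (real (Suc n)) \<and> real n < norm (T t)" for n
    proof (rule ccontr)
      assume "\<not> ?thesis"
      then have "\<forall>t\<in>{0<..inverse (real (Suc n))}. norm (T t) \<le> real n" by force
      moreover have "inverse (real (Suc n)) > 0" by simp
      ultimately show False using unbounded by blast
    qed
    then obtain r where r: "\<And>n. 0 < r n" "\<And>n. r n \<le> inverse (real (Suc n))"
      "\<And>n. real n < norm (T (r n))"
      by metis
    have r0: "r \<longlonglongrightarrow> 0"
      by (rule tendsto_sandwich[OF _ _ tendsto_const LIMSEQ_inverse_real_of_nat])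
         (auto intro!: always_eventually less_imp_le r simp del: of_nat_Suc)
    then have "filterlim r (at_right 0) sequentially"
      using r(1) by (intro tendsto_imp_filterlim_at_right) auto
    then have conv: "(\<lambda>n. T (r n) x) \<longlonglongrightarrow> x" for x
      by (rule filterlim_compose[OF lim])
    have "\<exists>M. \<forall>f\<in>range (\<lambda>n. T (r n)). norm (blinfun_apply f x) \<le> M" for x
      using BseqD[OF convergent_imp_Bseq[OF convergentI[OF conv[of x]]]] by blast
    from banach_steinhaus[OF this] obtain M where "\<forall>n. norm (T (r n)) \<le> M"
      by blast
    moreover obtain n where "M \<le> real n" using real_arch_simple by blast
    ultimately show False using r(3)[of n] by (smt (verit))
  qed
  then obtain d M where d: "d > 0" and M: "\<And>t. 0 < t \<Longrightarrow> t \<le> d \<Longrightarrow> norm (T t) \<le> M"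
    by (metis greaterThanAtMost_iff)
  \<comment> \<open>The maximum with 1 covers \<open>t = 0\<close>, where \<open>T 0\<close> is the
    identity.\<close>
  define K where "K = max 1 M"
  have K: "norm (T t) \<le> K" if "0 \<le> t" "t \<le> d" for t
    using M[of t] that T0 norm_blinfun_id_le by (cases "t = 0") (auto simp: K_def le_max_iff_disj)
  have *: "\<forall>t. 0 \<le> t \<and> t \<le> real (Suc n) * d \<longrightarrow> norm (T t) \<le> K ^ Suc n" for n
  proof (induction n)
    case (Suc n)
    show ?case
    proof (intro allI impI)
      fix t assume t: "0 \<le> t \<and> t \<le> real (Suc (Suc n)) * d"
      \<comment> \<open>A step of length at most \<open>d\<close> is split off; truncation at 0
        keeps \<open>s\<close> nonnegative when \<open>t < d\<close>.\<close>
      define s where "s = max 0 (t - d)"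
      have s: "0 \<le> s" "s \<le> real (Suc n) * d" "0 \<le> t - s" "t - s \<le> d"
        using t d by (auto simp: s_def algebra_simps max_def)
      have "norm (T t) = norm (T (t - s) o\<^sub>L T s)"
        using add[of s "t - s"] s by simp
      also have "\<dots> \<le> norm (T (t - s)) * norm (T s)"
        by (rule norm_blinfun_compose)
      also have "\<dots> \<le> K * K ^ Suc n"
        using Suc s K by (intro mult_mono) (auto simp: K_def)
      finally show "norm (T t) \<le> K ^ Suc (Suc n)" by simp
    qed
  qed (use K in auto)
  obtain n where "a / d \<le> real n" using real_arch_simple by blast
  then have "a \<le> real (Suc n) * d"
    using d by (simp add: pos_divide_le_eq distrib_right add_increasing)
  with * show ?thesis by (intro exI[of _ "K ^ Suc n"]) auto
qed

text \<open>Right continuity at 0 gives continuity from both sides: for \<open>r \<le> s\<close> the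
  difference of the values is \<open>T r (T (s - r) x - x)\<close>, and \<open>T r\<close> is
  locally bounded. Factoring out the earlier time treats both sides alike.\<close>

lemma C0_semigroup_continuous_on:
  fixes T :: "real \<Rightarrow> 'a::banach \<Rightarrow>\<^sub>L 'a"
  assumes T: "C0_semigroup T"
  shows "continuous_on {0..} (\<lambda>t. T t x)"
  unfolding continuous_on_iff
proof (intro ballI allI impI)
  fix t e :: real assume t: "t \<in> {0..}" and e: "e > 0"
  have T0: "T 0 = id_blinfun" and add: "\<And>s t. 0 \<le> s \<Longrightarrow> 0 \<le> t \<Longrightarrow> T (t + s) = T t o\<^sub>L T s"
    and lim: "((\<lambda>t. T t x) \<longlongrightarrow> x) (at_right 0)"
    using T by (auto simp: C0_semigroup_def)
  \<comment> \<open>The interval up to \<open>t + 1\<close> contains all times within distance 1 of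
    \<open>t\<close> that can occur.\<close>
  obtain M where M: "\<And>s. 0 \<le> s \<Longrightarrow> s \<le> t + 1 \<Longrightarrow> norm (T s) \<le> M"
    using C0_semigroup_locally_bounded[OF T, of "t + 1"] by (metis atLeastAtMost_iff)
  have M0: "M \<ge> 0" using order_trans[OF norm_ge_zero M[of 0]] t by simp
  have "e / (M + 1) > 0" using e M0 by simp
  then have "eventually (\<lambda>h. dist (T h x) x < e / (M + 1)) (at_right 0)"
    by (rule tendstoD[OF lim])
  then obtain b where b: "b > 0" "\<And>h. 0 < h \<Longrightarrow> h < b \<Longrightarrow> dist (T h x) x < e / (M + 1)"
    unfolding eventually_at_right_field by auto
  have main: "dist (T r x) (T s x) < e" if rs: "0 \<le> r" "r \<le> s" "s \<le> t + 1" "s - r < b" for r s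
  proof (cases "r = s")
    case False
    have "T s x - T r x = T r (T (s - r) x - x)"
      using add[of "s - r" r] rs by (simp add: blinfun.bilinear_simps)
    then have "dist (T r x) (T s x) \<le> norm (T r) * dist (T (s - r) x) x"
      using norm_blinfun[of "T r" "T (s - r) x - x"] by (metis dist_norm dist_commute)
    also have "\<dots> \<le> (M + 1) * dist (T (s - r) x) x"
      using M[of r] rs by (intro mult_right_mono) auto
    also have "\<dots> < e"
      using b(2)[of "s - r"] rs False M0 by (simp add: pos_less_divide_eq mult.commute)
    finally show ?thesis .
  qed (use e in simp)
  show "\<exists>d>0. \<forall>s\<in>{0..}. dist s t < d \<longrightarrow> dist (T s x) (T t x) < e"
  proof (intro exI[of _ "min 1 b"] conjI ballI impI)
    fix s :: real assume "s \<in> {0..}" "dist s t < min 1 b"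
    then show "dist (T s x) (T t x) < e"
      using main[of s t] main[of t s] t
      by (cases "s \<le> t") (auto simp: dist_real_def dist_commute)
  qed (use b in auto)
qed

text \<open>Convergence on elementary tensors follows from joint continuity of the tensor map and
  extends to sums. The eventual bound \<open>M * M\<close> on the operators passes it on to the
  completion, where algebraic tensors are dense.\<close>

lemma tendsto_ptensor_map:
  fixes T :: "'c \<Rightarrow> 'a::real_normed_vector \<Rightarrow>\<^sub>L 'a" and A :: "'a \<Rightarrow>\<^sub>L 'a"
  assumes bdd: "\<forall>\<^sub>F t in F. norm (T t) \<le> M" and lim: "\<And>x. ((\<lambda>t. T t x) \<longlongrightarrow> A x) F"
  shows "((\<lambda>t. ptensor_map (T t) \<rho>) \<longlongrightarrow> ptensor_map A \<rho>) F"
proof (rule tendstoI)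
  fix e :: real assume e: "e > 0"
  \<comment> \<open>\<open>K\<close> absorbs the effect of both operators on the approximation
    error; the summand 1 keeps it positive.\<close>
  define K where "K = M * M + norm (ptensor_map A) + 1"
  have K: "K > 0" by (simp add: K_def add_nonneg_pos)
  with e have "e / (2 * K) > 0" by simp
  moreover obtain s where "(\<lambda>n. of_tensor (s n)) \<longlonglongrightarrow> \<rho>" by (rule ptensor_approx)
  ultimately obtain n where "norm (of_tensor (s n) - \<rho>) < e / (2 * K)"
    using LIMSEQ_D by blast
  then obtain \<tau> where \<tau>: "norm (\<rho> - of_tensor \<tau>) < e / (2 * K)"
    by (metis norm_minus_commute)
  have "((\<lambda>t. ptensor_map (T t) (of_tensor \<tau>)) \<longlongrightarrow> ptensor_map A (of_tensor \<tau>)) F"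
  proof (induction \<tau> rule: tensor_induct)
    case (add \<tau> \<sigma>)
    then show ?case
      by (simp add: linear_add[OF linear_of_tensor] blinfun.bilinear_simps tendsto_add)
  next
    case (elem x y)
    show ?case
      by (simp add: bounded_bilinear.tendsto[OF bounded_bilinear_of_tensor_elem] lim)
  qed
  then have "\<forall>\<^sub>F t in F. dist (ptensor_map (T t) (of_tensor \<tau>)) (ptensor_map A (of_tensor \<tau>)) < e / 2"
    using e by (intro tendstoD) auto
  with bdd show "\<forall>\<^sub>F t in F. dist (ptensor_map (T t) \<rho>) (ptensor_map A \<rho>) < e"
  proof eventually_elim
    case (elim t)
    let ?d = "\<rho> - of_tensor \<tau>"
    have "norm (ptensor_map (T t) ?d) \<le> norm (ptensor_map (T t)) * norm ?d"
      by (rule norm_blinfun)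
    also have "\<dots> \<le> M * M * norm ?d"
      using elim(1) by (intro mult_right_mono order_trans[OF norm_ptensor_map_le] mult_mono)
        (auto intro: order_trans[OF norm_ge_zero])
    finally have "norm (ptensor_map (T t) ?d) + norm (ptensor_map A ?d) \<le> K * norm ?d"
      using norm_blinfun[of "ptensor_map A" ?d] norm_ge_zero[of ?d]
      by (simp add: K_def distrib_right del: norm_ge_zero)
    also have "\<dots> < e / 2"
      using \<tau> K by (simp add: field_simps)
    finally have 1: "norm (ptensor_map (T t) ?d) + norm (ptensor_map A ?d) < e / 2" .
    have "ptensor_map (T t) \<rho> - ptensor_map A \<rho> = (ptensor_map (T t) ?d - ptensor_map A ?d) +
        (ptensor_map (T t) (of_tensor \<tau>) - ptensor_map A (of_tensor \<tau>))"
      by (simp add: blinfun.bilinear_simps)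
    then have "norm (ptensor_map (T t) \<rho> - ptensor_map A \<rho>) \<le> norm (ptensor_map (T t) ?d - ptensor_map A ?d) +
        norm (ptensor_map (T t) (of_tensor \<tau>) - ptensor_map A (of_tensor \<tau>))"
      by (metis norm_triangle_ineq)
    with 1 elim(2) norm_triangle_ineq4[of "ptensor_map (T t) ?d" "ptensor_map A ?d"]
    show ?case by (simp add: dist_norm)
  qed
qed

lemma C0_semigroup_ptensor_map:
  fixes T :: "real \<Rightarrow> 'a::banach \<Rightarrow>\<^sub>L 'a"
  assumes T: "C0_semigroup T"
  shows "C0_semigroup (\<lambda>t. ptensor_map (T t))"
  unfolding C0_semigroup_def
proof (intro conjI allI impI)
  show "ptensor_map (T 0) = id_blinfun"
    using T by (simp add: C0_semigroup_def ptensor_map_id)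
  show "ptensor_map (T (t + s)) = ptensor_map (T t) o\<^sub>L ptensor_map (T s)" if "0 \<le> t" "0 \<le> s" for t s
    using T that by (simp add: C0_semigroup_def ptensor_map_compose)
  fix \<rho> :: "'a ptensor"
  obtain M where M: "\<forall>t\<in>{0..1}. norm (T t) \<le> M"
    using C0_semigroup_locally_bounded[OF T] by blast
  have "\<forall>\<^sub>F t in at_right 0. norm (T t) \<le> M"
    using M by (auto intro!: eventually_at_rightI[of 0 1])
  moreover have "((\<lambda>t. T t x) \<longlongrightarrow> id_blinfun x) (at_right 0)" for x
    using T by (simp add: C0_semigroup_def)
  ultimately have "((\<lambda>t. ptensor_map (T t) \<rho>) \<longlongrightarrow> ptensor_map id_blinfun \<rho>) (at_right 0)"
    by (rule tendsto_ptensor_map)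
  then show "((\<lambda>t. ptensor_map (T t) \<rho>) \<longlongrightarrow> \<rho>) (at_right 0)"
    by (simp add: ptensor_map_id)
qed

section \<open>The symmetric tensors and their positive cone\<close>

lemma subspace_closure:
  fixes S :: "'a::real_normed_vector set"
  assumes S: "subspace S"
  shows "subspace (closure S)"
  unfolding subspace_def
proof (intro conjI ballI allI)
  show "0 \<in> closure S"
    by (rule subsetD[OF closure_subset subspace_0[OF S]])
next
  fix x y assume "x \<in> closure S" "y \<in> closure S"
  then obtain r s where r: "\<forall>n. r n \<in> S" "r \<longlonglongrightarrow> x" and s: "\<forall>n. s n \<in> S" "s \<longlonglongrightarrow> y"
    unfolding closure_sequential by (elim exE conjE) (rule that)
  from r(1) s(1) have "\<forall>n. r n + s n \<in> S" by (simp add: subspace_add[OF S])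
  with tendsto_add[OF r(2) s(2)] show "x + y \<in> closure S"
    unfolding closure_sequential by (intro exI[of _ "\<lambda>n. r n + s n"] conjI)
next
  fix c x assume "x \<in> closure S"
  then obtain r where r: "\<forall>n. r n \<in> S" "r \<longlonglongrightarrow> x"
    unfolding closure_sequential by (elim exE conjE) (rule that)
  from r(1) have "\<forall>n. c *\<^sub>R r n \<in> S" by (simp add: subspace_mul[OF S])
  with tendsto_scaleR[OF tendsto_const r(2)] show "c *\<^sub>R x \<in> closure S"
    unfolding closure_sequential by (intro exI[of _ "\<lambda>n. c *\<^sub>R r n"] conjI)
qed

lemma subspace_sym_ptensor: "subspace sym_ptensor"
  unfolding sym_ptensor_def sym_tensor_def
  by (rule subspace_closure[OF linear_subspace_image[OF linear_of_tensor subspace_span]])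

lemma sym_elem_in_sym_ptensor: "of_tensor (x \<otimes> y) + of_tensor (y \<otimes> x) \<in> sym_ptensor"
proof -
  have "x \<otimes> y + y \<otimes> x \<in> sym_tensor"
    unfolding sym_tensor_def by (rule span_base) blast
  then show ?thesis
    unfolding sym_ptensor_def
    using closure_subset by (force simp flip: linear_add[OF linear_of_tensor])
qed

text \<open>Since \<open>sym_ptensor\<close> is the closure of the image of a span, it lies in every
  closed subspace that contains the symmetrized elementary tensors.\<close>

lemma sym_ptensor_induct [consumes 1, case_names closed subspace elem]:
  assumes "\<rho> \<in> sym_ptensor"
    and closed: "closed {\<rho>. Q \<rho>}" and sub: "subspace {\<rho>. Q \<rho>}"
    and elem: "\<And>x y. Q (of_tensor (x \<otimes> y) + of_tensor (y \<otimes> x))"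
  shows "Q \<rho>"
proof -
  have "of_tensor \<tau> \<in> {\<rho>. Q \<rho>}" if "\<tau> \<in> sym_tensor" for \<tau>
    using that unfolding sym_tensor_def
  proof (induction rule: span_induct)
    case base
    show ?case
      using linear_subspace_vimage[OF linear_of_tensor sub] by (simp add: vimage_def)
  next
    case (step \<tau>)
    then show ?case using elem by (auto simp: linear_add[OF linear_of_tensor])
  qed
  then have "of_tensor ` sym_tensor \<subseteq> {\<rho>. Q \<rho>}" by blast
  then have "sym_ptensor \<subseteq> {\<rho>. Q \<rho>}"
    unfolding sym_ptensor_def by (rule closure_minimal[OF _ closed])
  with assms(1) show ?thesis by blast
qed

lemma sym_ptensor_linear_eqI:
  assumes "\<rho> \<in> sym_ptensor" and f: "bounded_linear f" and g: "bounded_linear g"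
    and "\<And>x y. f (of_tensor (x \<otimes> y) + of_tensor (y \<otimes> x)) = g (of_tensor (x \<otimes> y) + of_tensor (y \<otimes> x))"
  shows "f \<rho> = g \<rho>"
  using assms(1)
proof (induction rule: sym_ptensor_induct)
  case closed
  show ?case by (intro closed_Collect_eq linear_continuous_on f g)
next
  case subspace
  show ?case
    using linear_subspace_kernel[OF linear_compose_sub[OF f[THEN bounded_linear.linear]
          g[THEN bounded_linear.linear]]] by simp
qed (rule assms(4))

lemma ptensor_map_sym:
  assumes "\<rho> \<in> sym_ptensor"
  shows "ptensor_map A \<rho> \<in> sym_ptensor"
  using assms
proof (induction rule: sym_ptensor_induct)
  case closed
  have "closed (ptensor_map A -` sym_ptensor)"
    unfolding sym_ptensor_def
    by (intro closed_vimage closed_closure linear_continuous_on blinfun.bounded_linear_right)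
  then show ?case by (simp add: vimage_def)
next
  case subspace
  have "linear (blinfun_apply (ptensor_map A))"
    by (intro bounded_linear.linear blinfun.bounded_linear_right)
  then show ?case
    using linear_subspace_vimage[OF _ subspace_sym_ptensor] by (simp add: vimage_def)
next
  case (elem x y)
  show ?case by (simp add: blinfun.bilinear_simps sym_elem_in_sym_ptensor)
qed

text \<open>A functional \<open>f\<close> norming \<open>\<sigma> - \<tau>\<close> becomes a
  symmetric operator after symmetrization, and pairing with this operator still recovers
  \<open>f\<close> on symmetric tensors.\<close>

proposition sym_ops_separate:
  assumes \<sigma>: "\<sigma> \<in> sym_ptensor" and \<tau>: "\<tau> \<in> sym_ptensor"
    and eq: "\<And>P. P \<in> sym_ops \<Longrightarrow> pairing P \<sigma> = pairing P \<tau>"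
  shows "\<sigma> = \<tau>"
proof -
  obtain f :: "'a ptensor \<Rightarrow>\<^sub>L real" where f: "f (\<sigma> - \<tau>) = norm (\<sigma> - \<tau>)"
    by (rule norming_functional)
  interpret of_tensor_elem: bounded_bilinear "\<lambda>x y. of_tensor (x \<otimes> y)"
    by (rule bounded_bilinear_of_tensor_elem)
  \<comment> \<open>\<open>prod_right x\<close> sends \<open>y\<close> to the image of
    \<open>x \<otimes> y\<close>, \<open>prod_left x\<close> to that of
    \<open>y \<otimes> x\<close>; so \<open>P\<close> is the symmetrization of \<open>f\<close> in
    curried form.\<close>
  define P :: "'a \<Rightarrow>\<^sub>L 'a \<Rightarrow>\<^sub>L real" where
    "P = Blinfun (\<lambda>x. f o\<^sub>L (of_tensor_elem.prod_right x + of_tensor_elem.prod_left x))"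
  have "bounded_linear (\<lambda>x. f o\<^sub>L (of_tensor_elem.prod_right x + of_tensor_elem.prod_left x))"
    by (rule bounded_linear_compose[OF
          bounded_bilinear.bounded_linear_right[OF bounded_bilinear_blinfun_compose]
          bounded_linear_add[OF of_tensor_elem.bounded_linear_prod_right of_tensor_elem.bounded_linear_prod_left]])
  then have P: "P x y = f (of_tensor (x \<otimes> y) + of_tensor (y \<otimes> x))" for x y
    by (simp add: P_def bounded_linear_Blinfun_apply blinfun.bilinear_simps)
  have "P \<in> sym_ops" by (simp add: sym_ops_def P add.commute)
  \<comment> \<open>The two halves of \<open>P\<close> contribute equally, as swapping the factors
    fixes symmetric tensors.\<close>
  have "pairing P \<rho> = 2 * f \<rho>" if "\<rho> \<in> sym_ptensor" for \<rho>
  proof (rule sym_ptensor_linear_eqI[OF that bounded_linear_pairing])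
    show "pairing P (of_tensor (x \<otimes> y) + of_tensor (y \<otimes> x)) =
        2 * f (of_tensor (x \<otimes> y) + of_tensor (y \<otimes> x))" for x y
      by (simp add: linear_add[OF bounded_linear.linear[OF bounded_linear_pairing]] P add.commute)
  qed (intro bounded_linear_const_mult blinfun.bounded_linear_right)
  with \<sigma> \<tau> eq[OF \<open>P \<in> sym_ops\<close>] have "f \<sigma> = f \<tau>" by simp
  then have "norm (\<sigma> - \<tau>) = 0"
    using f by (simp add: blinfun.bilinear_simps)
  then show ?thesis by simp
qed

section \<open>The positive cone and its generating property\<close>

lemma pos_cone_add: "\<rho> \<in> pos_cone \<Longrightarrow> \<sigma> \<in> pos_cone \<Longrightarrow> \<rho> + \<sigma> \<in> pos_cone"
  by (auto simp: pos_cone_def subspace_add[OF subspace_sym_ptensor]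
      linear_add[OF bounded_linear.linear[OF bounded_linear_pairing]])

lemma pos_cone_scaleR: "0 \<le> c \<Longrightarrow> \<rho> \<in> pos_cone \<Longrightarrow> c *\<^sub>R \<rho> \<in> pos_cone"
  by (auto simp: pos_cone_def subspace_mul[OF subspace_sym_ptensor]
      linear_scale[OF bounded_linear.linear[OF bounded_linear_pairing]])

lemma zero_in_pos_cone: "0 \<in> pos_cone"
  by (auto simp: pos_cone_def subspace_0[OF subspace_sym_ptensor]
      linear_0[OF bounded_linear.linear[OF bounded_linear_pairing]])

lemma closed_pos_cone: "closed pos_cone"
proof -
  have "pos_cone = sym_ptensor \<inter> (\<Inter>P\<in>pos_sym_ops. {\<rho>. 0 \<le> pairing P \<rho>})"
    by (auto simp: pos_cone_def)
  also have "closed \<dots>"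
    unfolding sym_ptensor_def
    by (intro closed_Int closed_closure closed_INT ballI closed_Collect_le continuous_on_const
        linear_continuous_on bounded_linear_pairing)
  finally show ?thesis .
qed

lemma suminf_in_pos_cone:
  assumes "\<And>n. a n \<in> pos_cone" "summable a"
  shows "suminf a \<in> pos_cone"
proof (rule closed_sequentially[OF closed_pos_cone])
  show "(\<lambda>n. \<Sum>i<n. a i) \<longlonglongrightarrow> suminf a"
    using assms(2) by (rule summable_LIMSEQ)
  show "(\<Sum>i<n. a i) \<in> pos_cone" for n
    by (induction n) (auto intro: assms pos_cone_add zero_in_pos_cone)
qed

lemma square_in_pos_cone: "of_tensor (x \<otimes> x) \<in> pos_cone"
proof -
  have "(1 / 2) *\<^sub>R (of_tensor (x \<otimes> x) + of_tensor (x \<otimes> x)) \<in> sym_ptensor"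
    by (intro subspace_mul[OF subspace_sym_ptensor] sym_elem_in_sym_ptensor)
  then have "of_tensor (x \<otimes> x) \<in> sym_ptensor"
    by (simp only: scaleR_half_double)
  then show ?thesis by (auto simp: pos_cone_def pos_sym_ops_def)
qed

text \<open>Polarization. Rescaling \<open>x\<close> and \<open>y\<close> to have equal norms leaves \<open>x \<otimes> y\<close> unchanged and makes
  the squares as small as \<open>\<parallel>x\<parallel> \<parallel>y\<parallel>\<close>.\<close>

lemma elem_polarization:
  fixes x y :: "'a::real_normed_vector"
  obtains a b where "a \<in> pos_cone" "b \<in> pos_cone"
    "of_tensor (x \<otimes> y) + of_tensor (y \<otimes> x) = 2 *\<^sub>R (a - b)"
    "norm a \<le> norm x * norm y" "norm b \<le> norm x * norm y"
proof (cases "x = 0 \<or> y = 0")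
  case True
  then show ?thesis
    using that[of 0 0] zero_in_pos_cone
    by (auto simp: bilinear_lzero[OF bilinear_of_tensor_elem] bilinear_rzero[OF bilinear_of_tensor_elem]
        bilinear_lzero[OF elem_tensor_bilinear] bilinear_rzero[OF elem_tensor_bilinear]
        linear_0[OF linear_of_tensor])
next
  case False
  define c where "c = sqrt (norm y / norm x)"
  define u where "u = c *\<^sub>R x"
  define v where "v = inverse c *\<^sub>R y"
  have c: "c > 0" using False by (simp add: c_def)
  have c2: "c * c = norm y / norm x" by (simp add: c_def)
  have "norm u * norm u = (c * c) * (norm x * norm x)"
    using c by (simp add: u_def)
  then have nu: "norm u * norm u = norm x * norm y"
    unfolding c2 using False by simp
  have "norm v * norm v = (norm y * norm y) / (c * c)"
    using c by (simp add: v_def divide_simps)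
  then have nv: "norm v * norm v = norm x * norm y"
    unfolding c2 using False by simp
  have uv: "norm v = norm u"
    by (rule power2_eq_imp_eq) (simp_all add: power2_eq_square nu nv)
  note bil = bilinear_ladd[OF bilinear_of_tensor_elem] bilinear_radd[OF bilinear_of_tensor_elem]
    bilinear_lsub[OF bilinear_of_tensor_elem] bilinear_rsub[OF bilinear_of_tensor_elem]
    bilinear_lmul[OF bilinear_of_tensor_elem] bilinear_rmul[OF bilinear_of_tensor_elem]
  define a where "a = (1 / 4) *\<^sub>R of_tensor ((u + v) \<otimes> (u + v))"
  define b where "b = (1 / 4) *\<^sub>R of_tensor ((u - v) \<otimes> (u - v))"
  \<comment> \<open>Both \<open>u + v\<close> and \<open>u - v\<close> have norm at most
    \<open>2 * norm u\<close>, because \<open>u\<close> and \<open>v\<close> have equal norms. The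
    resulting factor 4 cancels against \<open>1 / 4\<close>.\<close>
  have le: "norm ((1 / 4) *\<^sub>R of_tensor (w \<otimes> w)) \<le> norm x * norm y" if "norm w \<le> 2 * norm u" for w
  proof -
    have "norm (of_tensor (w \<otimes> w)) \<le> (2 * norm u) * (2 * norm u)"
      using that by (intro order_trans[OF norm_of_tensor_elem_le] mult_mono) auto
    then show ?thesis using nu by simp
  qed
  show ?thesis
  proof
    show "a \<in> pos_cone" "b \<in> pos_cone"
      by (auto simp: a_def b_def intro: pos_cone_scaleR square_in_pos_cone)
    have "of_tensor ((u + v) \<otimes> (u + v)) - of_tensor ((u - v) \<otimes> (u - v)) =
        2 *\<^sub>R (of_tensor (u \<otimes> v) + of_tensor (v \<otimes> u))"
      by (simp add: bil scaleR_2)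
    then have "2 *\<^sub>R (a - b) = of_tensor (u \<otimes> v) + of_tensor (v \<otimes> u)"
      by (simp add: a_def b_def flip: scaleR_diff_right)
    also have "\<dots> = of_tensor (x \<otimes> y) + of_tensor (y \<otimes> x)"
      using c by (simp add: u_def v_def bil)
    finally show "of_tensor (x \<otimes> y) + of_tensor (y \<otimes> x) = 2 *\<^sub>R (a - b)" by simp
    show "norm a \<le> norm x * norm y"
      unfolding a_def using norm_triangle_ineq[of u v] uv by (intro le) simp
    show "norm b \<le> norm x * norm y"
      unfolding b_def using norm_triangle_ineq4[of u v] uv by (intro le) simp
  qed
qed

text \<open>Approximating algebraic tensors need not be symmetric. Adding the swapped tensor
  symmetrizes them and doubles a limit that is already symmetric.\<close>

lemma ex_swap:
  obtains S :: "'a::real_normed_vector ptensor \<Rightarrow>\<^sub>L 'a ptensor"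
  where "\<And>x y. S (of_tensor (x \<otimes> y)) = of_tensor (y \<otimes> x)" "\<And>\<rho>. \<rho> \<in> sym_ptensor \<Longrightarrow> S \<rho> = \<rho>"
proof -
  have bil: "bilinear (\<lambda>x y :: 'a. of_tensor (y \<otimes> x))"
    using bilinear_of_tensor_elem by (auto simp: bilinear_def)
  have le: "norm (of_tensor (y \<otimes> x)) \<le> 1 * (norm x * norm y)" for x y :: 'a
    using norm_of_tensor_elem_le[of y x] by (simp add: mult.commute)
  obtain S :: "'a ptensor \<Rightarrow>\<^sub>L 'a ptensor" where
    S: "\<And>x y. S (of_tensor (x \<otimes> y)) = of_tensor (y \<otimes> x)"
    by (rule ex_ptensor_lift[OF bil le zero_le_one]) (rule that)
  have "S \<rho> = \<rho>" if "\<rho> \<in> sym_ptensor" for \<rho>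
    by (rule sym_ptensor_linear_eqI[OF that blinfun.bounded_linear_right bounded_linear_ident])
       (simp add: S blinfun.bilinear_simps add.commute)
  with S that show ?thesis by blast
qed

text \<open>Each term of a nearly optimal representation is polarized separately. The induction
  carries the representation's own cost as the bound, which grows term by term and stays below
  \<open>e\<close>.\<close>

lemma tensor_polarization:
  fixes S :: "'a::real_normed_vector ptensor \<Rightarrow>\<^sub>L 'a ptensor"
  assumes S: "\<And>x y. S (of_tensor (x \<otimes> y)) = of_tensor (y \<otimes> x)" and e: "proj_norm \<tau> < e"
  shows "\<exists>a\<in>pos_cone. \<exists>b\<in>pos_cone. of_tensor \<tau> + S (of_tensor \<tau>) = 2 *\<^sub>R (a - b) \<and>
    norm a \<le> e \<and> norm b \<le> e"
proof -
  obtain m where m: "\<tau> = (\<Sum>(x, y)\<in>#m. x \<otimes> y)" "(\<Sum>(x, y)\<in>#m. norm x * norm y) < e"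
    using proj_norm_approx[OF e] by blast
  have "\<exists>a\<in>pos_cone. \<exists>b\<in>pos_cone.
      of_tensor (\<Sum>(x, y)\<in>#m. x \<otimes> y) + S (of_tensor (\<Sum>(x, y)\<in>#m. x \<otimes> y)) = 2 *\<^sub>R (a - b) \<and>
      norm a \<le> (\<Sum>(x, y)\<in>#m. norm x * norm y) \<and> norm b \<le> (\<Sum>(x, y)\<in>#m. norm x * norm y)"
  proof (induction m)
    case empty
    show ?case
      by (intro bexI[OF _ zero_in_pos_cone]) (simp add: linear_0[OF linear_of_tensor])
  next
    case (add z m)
    obtain x y where z: "z = (x, y)" by fastforce
    obtain a b where ab: "a \<in> pos_cone" "b \<in> pos_cone"
      "of_tensor (\<Sum>(x, y)\<in>#m. x \<otimes> y) + S (of_tensor (\<Sum>(x, y)\<in>#m. x \<otimes> y)) = 2 *\<^sub>R (a - b)"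
      "norm a \<le> (\<Sum>(x, y)\<in>#m. norm x * norm y)" "norm b \<le> (\<Sum>(x, y)\<in>#m. norm x * norm y)"
      using add by blast
    obtain a' b' where ab': "a' \<in> pos_cone" "b' \<in> pos_cone"
      "of_tensor (x \<otimes> y) + of_tensor (y \<otimes> x) = 2 *\<^sub>R (a' - b')"
      "norm a' \<le> norm x * norm y" "norm b' \<le> norm x * norm y"
      by (rule elem_polarization)
    show ?case
    proof (rule bexI[of _ "a' + a"], rule bexI[of _ "b' + b"], intro conjI)
      let ?s = "of_tensor (\<Sum>(x, y)\<in>#m. x \<otimes> y)"
      have "of_tensor (\<Sum>(x, y)\<in>#add_mset z m. x \<otimes> y) + S (of_tensor (\<Sum>(x, y)\<in>#add_mset z m. x \<otimes> y))
        = (of_tensor (x \<otimes> y) + of_tensor (y \<otimes> x)) + (?s + S ?s)"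
        by (simp add: z linear_add[OF linear_of_tensor] blinfun.bilinear_simps S)
      also have "\<dots> = 2 *\<^sub>R (a' + a - (b' + b))"
        unfolding ab'(3) ab(3) by (simp add: algebra_simps)
      finally show "of_tensor (\<Sum>(x, y)\<in>#add_mset z m. x \<otimes> y) +
        S (of_tensor (\<Sum>(x, y)\<in>#add_mset z m. x \<otimes> y)) = 2 *\<^sub>R (a' + a - (b' + b))" .
      show "norm (a' + a) \<le> (\<Sum>(x, y)\<in>#add_mset z m. norm x * norm y)"
        using ab ab' by (simp add: z norm_triangle_mono)
      show "norm (b' + b) \<le> (\<Sum>(x, y)\<in>#add_mset z m. norm x * norm y)"
        using ab ab' by (simp add: z norm_triangle_mono)
    qed (use ab ab' pos_cone_add in auto)
  qed
  then show ?thesis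
    unfolding m(1)[symmetric] using m(2) by (meson less_imp_le order_trans)
qed

text \<open>Telescoping a fast approximation of \<open>\<rho>\<close> writes it as a series whose
  increments have geometrically small projective norm. After symmetrization each increment splits
  into cone elements of comparable norm, so the two series converge, and their sums stay in the
  closed cone.\<close>

theorem pos_cone_generating:
  "(sym_ptensor :: 'a::real_normed_vector ptensor set) = {\<rho> - \<sigma> | \<rho> \<sigma>. \<rho> \<in> pos_cone \<and> \<sigma> \<in> pos_cone}"
proof (intro equalityI subsetI)
  fix \<rho> :: "'a ptensor" assume "\<rho> \<in> {\<rho> - \<sigma> | \<rho> \<sigma>. \<rho> \<in> pos_cone \<and> \<sigma> \<in> pos_cone}"
  then show "\<rho> \<in> sym_ptensor"
    by (auto simp: pos_cone_def intro: subspace_diff[OF subspace_sym_ptensor])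
next
  fix \<rho> :: "'a ptensor" assume \<rho>: "\<rho> \<in> sym_ptensor"
  obtain S :: "'a ptensor \<Rightarrow>\<^sub>L 'a ptensor" where
    S: "\<And>x y. S (of_tensor (x \<otimes> y)) = of_tensor (y \<otimes> x)" "S \<rho> = \<rho>"
    using ex_swap \<rho> by metis
  have "\<exists>\<tau>. norm (of_tensor \<tau> - \<rho>) < (1 / 2) ^ n" for n
  proof -
    obtain s where "(\<lambda>n. of_tensor (s n)) \<longlonglongrightarrow> \<rho>" by (rule ptensor_approx)
    then show ?thesis using LIMSEQ_D[of _ \<rho> "(1 / 2) ^ n"] by fastforce
  qed
  then obtain s where s: "\<And>n. norm (of_tensor (s n) - \<rho>) < (1 / 2) ^ n"
    by metis
  define \<tau> where "\<tau> n = s (Suc n) - s n" for n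
  have "proj_norm (\<tau> n) < 2 * (1 / 2) ^ n" for n
  proof -
    have "of_tensor (\<tau> n) = (of_tensor (s (Suc n)) - \<rho>) - (of_tensor (s n) - \<rho>)"
      by (simp add: \<tau>_def linear_diff[OF linear_of_tensor])
    then have "norm (of_tensor (\<tau> n)) \<le> norm (of_tensor (s (Suc n)) - \<rho>) + norm (of_tensor (s n) - \<rho>)"
      by (metis norm_triangle_ineq4)
    also have "\<dots> < (1 / 2) ^ Suc n + (1 / 2) ^ n"
      by (intro add_strict_mono s)
    also have "\<dots> \<le> 2 * (1 / 2) ^ n" by simp
    finally show ?thesis by simp
  qed
  then have "\<exists>a\<in>pos_cone. \<exists>b\<in>pos_cone. of_tensor (\<tau> n) + S (of_tensor (\<tau> n)) = 2 *\<^sub>R (a - b) \<and>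
      norm a \<le> 2 * (1 / 2) ^ n \<and> norm b \<le> 2 * (1 / 2) ^ n" for n
    by (intro tensor_polarization S)
  then obtain a b where ab: "\<And>n. a n \<in> pos_cone" "\<And>n. b n \<in> pos_cone"
    "\<And>n. of_tensor (\<tau> n) + S (of_tensor (\<tau> n)) = 2 *\<^sub>R (a n - b n)"
    "\<And>n. norm (a n) \<le> 2 * (1 / 2) ^ n" "\<And>n. norm (b n) \<le> 2 * (1 / 2) ^ n"
    by metis
  have geo: "summable (\<lambda>n. 2 * (1 / 2 :: real) ^ n)"
    by (intro summable_mult summable_geometric) simp
  have sa: "summable a" and sb: "summable b"
    by (rule summable_comparison_test'[OF geo], use ab in blast)+
  \<comment> \<open>The initial term of the telescope is split separately; adding 1 merely supplies
    a number above its norm.\<close>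
  obtain a0 b0 where ab0: "a0 \<in> pos_cone" "b0 \<in> pos_cone"
    "of_tensor (s 0) + S (of_tensor (s 0)) = 2 *\<^sub>R (a0 - b0)"
    using tensor_polarization[OF S(1), of "s 0" "proj_norm (s 0) + 1"] by auto
  have lim: "(\<lambda>n. of_tensor (s n)) \<longlonglongrightarrow> \<rho>"
  proof (rule LIM_zero_cancel, rule Lim_null_comparison)
    show "\<forall>\<^sub>F n in sequentially. norm (of_tensor (s n) - \<rho>) \<le> (1 / 2) ^ n"
      using s by (simp add: less_imp_le)
    show "(\<lambda>n. (1 / 2 :: real) ^ n) \<longlonglongrightarrow> 0"
      by (rule LIMSEQ_realpow_zero) auto
  qed
  \<comment> \<open>\<open>?F\<close> doubles \<open>\<rho>\<close>, which matches the factor 2 in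
    the polarization identities.\<close>
  let ?F = "\<lambda>\<sigma>. \<sigma> + S \<sigma>"
  have "(\<lambda>n. ?F (of_tensor (s n))) \<longlonglongrightarrow> ?F \<rho>"
    by (intro tendsto_add lim blinfun.tendsto tendsto_const)
  then have "(\<lambda>n. ?F (of_tensor (s (Suc n))) - ?F (of_tensor (s n))) sums (?F \<rho> - ?F (of_tensor (s 0)))"
    by (rule telescope_sums)
  moreover have "?F (of_tensor (s (Suc n))) - ?F (of_tensor (s n)) = 2 *\<^sub>R (a n - b n)" for n
    using ab(3)[of n] by (simp add: add_diff_add \<tau>_def linear_diff[OF linear_of_tensor] blinfun.bilinear_simps)
  ultimately have "(\<lambda>n. 2 *\<^sub>R (a n - b n)) sums (2 *\<^sub>R \<rho> - 2 *\<^sub>R (a0 - b0))"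
    by (simp only: ab0(3) S(2) scaleR_2)
  moreover have "(\<lambda>n. 2 *\<^sub>R (a n - b n)) sums (2 *\<^sub>R (suminf a - suminf b))"
    by (intro sums_scaleR_right sums_diff summable_sums sa sb)
  ultimately have "2 *\<^sub>R \<rho> - 2 *\<^sub>R (a0 - b0) = 2 *\<^sub>R (suminf a - suminf b)"
    by (rule sums_unique2)
  then have "2 *\<^sub>R \<rho> = 2 *\<^sub>R ((a0 + suminf a) - (b0 + suminf b))"
    by (simp add: algebra_simps)
  then have "\<rho> = (a0 + suminf a) - (b0 + suminf b)"
    by simp
  then show "\<rho> \<in> {\<rho> - \<sigma> | \<rho> \<sigma>. \<rho> \<in> pos_cone \<and> \<sigma> \<in> pos_cone}"
    using pos_cone_add suminf_in_pos_cone ab ab0 sa sb by blast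
qed

section \<open>The weak* topology and the Lyapunov semigroup\<close>

lemma linear_pairing_left: "linear (\<lambda>P. pairing P \<rho>)"
  by (rule bounded_linear.linear[OF bounded_linear_pairing_left])

lemma pairing_sym_elem:
  "pairing P (of_tensor (x \<otimes> y) + of_tensor (y \<otimes> x)) = P x y + P y x"
  by (simp add: linear_add[OF bounded_linear.linear[OF bounded_linear_pairing]])

lemma subspace_sym_ops: "subspace sym_ops"
  by (auto simp: subspace_def sym_ops_def blinfun.bilinear_simps)

text \<open>The universal property of an initial topology: continuity is tested on the defining
  functionals.\<close>

lemma continuous_map_into_weak_star:
  assumes "\<And>x. x \<in> topspace X \<Longrightarrow> f x \<in> sym_ops"
    and "\<And>\<rho>. \<rho> \<in> sym_ptensor \<Longrightarrow> continuous_map X euclideanreal (\<lambda>x. pairing (f x) \<rho>)"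
  shows "continuous_map X weak_star f"
  unfolding weak_star_def
proof (rule continuous_map_pullback')
  show "continuous_map X (product_topology (\<lambda>_. euclideanreal) sym_ptensor)
      ((\<lambda>P. \<lambda>\<rho>\<in>sym_ptensor. pairing P \<rho>) \<circ> f)"
    using assms(2) by (intro continuous_map_coordinatewise_then_product) auto
qed (use assms(1) in auto)

lemma openin_weak_star_strip:
  assumes "finite F" "F \<subseteq> sym_ptensor"
  shows "openin weak_star {P \<in> sym_ops. \<forall>\<rho>\<in>F. \<bar>pairing P \<rho>\<bar> < e}"
  using assms
proof (induction F)
  case empty
  have "openin weak_star (topspace weak_star)" by (rule openin_topspace)
  then show ?case by simp
next
  case (insert \<rho> F)
  have "openin weak_star {P \<in> topspace weak_star. pairing P \<rho> \<in> {- e<..<e}}"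
    using insert.prems by (intro openin_continuous_map_preimage[OF continuous_map_weak_star_pairing]) auto
  with insert have "openin weak_star ({P \<in> sym_ops. \<forall>\<rho>\<in>F. \<bar>pairing P \<rho>\<bar> < e} \<inter>
      {P \<in> topspace weak_star. pairing P \<rho> \<in> {- e<..<e}})"
    by (intro openin_Int) auto
  also have "\<dots> = {P \<in> sym_ops. \<forall>\<rho>\<in>insert \<rho> F. \<bar>pairing P \<rho>\<bar> < e}"
    by (auto simp: abs_less_iff)
  finally show ?case .
qed

text \<open>A basic open set of the product restricts only finitely many coordinates. These form
  \<open>F\<close>, and the least of the radii available there serves as \<open>e\<close>.\<close>

lemma weak_star_nbhd_0:
  assumes U: "openin weak_star U" "0 \<in> U"
  obtains F e where "finite F" "F \<subseteq> sym_ptensor" "e > 0"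
    "{P \<in> sym_ops. \<forall>\<rho>\<in>F. \<bar>pairing P \<rho>\<bar> < e} \<subseteq> U"
proof -
  let ?f = "\<lambda>P. \<lambda>\<rho>\<in>sym_ptensor. pairing P \<rho>"
  obtain V where V: "openin (product_topology (\<lambda>_. euclideanreal) sym_ptensor) V" "U = ?f -` V \<inter> sym_ops"
    using U(1) unfolding weak_star_def openin_pullback_topology by blast
  have f0: "?f 0 \<in> V" using U(2) V(2) by simp
  then obtain X where X: "?f 0 \<in> (\<Pi>\<^sub>E \<rho>\<in>sym_ptensor. X \<rho>)" "\<And>\<rho>. open (X \<rho>)"
    "finite {\<rho>. X \<rho> \<noteq> UNIV}" "(\<Pi>\<^sub>E \<rho>\<in>sym_ptensor. X \<rho>) \<subseteq> V"
    using product_topology_open_contains_basis[OF V(1) f0]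
    by (elim exE conjE) (rule that, simp_all)
  define F where "F = {\<rho> \<in> sym_ptensor. X \<rho> \<noteq> UNIV}"
  have F: "finite F" "F \<subseteq> sym_ptensor"
    using X(3) by (auto simp: F_def)
  have "\<exists>d>0. ball 0 d \<subseteq> X \<rho>" if "\<rho> \<in> sym_ptensor" for \<rho>
  proof -
    have "0 \<in> X \<rho>"
      using X(1) that linear_0[OF linear_pairing_left, of \<rho>] by (auto simp: PiE_iff)
    then show ?thesis using X(2) by (simp add: open_contains_ball)
  qed
  then obtain d where d: "\<And>\<rho>. \<rho> \<in> sym_ptensor \<Longrightarrow> d \<rho> > 0 \<and> ball 0 (d \<rho>) \<subseteq> X \<rho>"
    by metis
  \<comment> \<open>The inserted 1 keeps the minimum meaningful for empty \<open>F\<close>.\<close>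
  define e where "e = Min (insert 1 (d ` F))"
  have "e > 0" using F d by (auto simp: e_def)
  have e: "e \<le> d \<rho>" if "\<rho> \<in> F" for \<rho>
    using F that by (simp add: e_def)
  have "{P \<in> sym_ops. \<forall>\<rho>\<in>F. \<bar>pairing P \<rho>\<bar> < e} \<subseteq> U"
  proof
    fix P assume P: "P \<in> {P \<in> sym_ops. \<forall>\<rho>\<in>F. \<bar>pairing P \<rho>\<bar> < e}"
    have "pairing P \<rho> \<in> X \<rho>" if "\<rho> \<in> sym_ptensor" for \<rho>
    proof (cases "\<rho> \<in> F")
      case True
      with P e[OF True] have "pairing P \<rho> \<in> ball 0 (d \<rho>)" by (force simp: dist_real_def)
      with d[OF that] show ?thesis by blast
    qed (use that in \<open>auto simp: F_def\<close>)
    then have "?f P \<in> (\<Pi>\<^sub>E \<rho>\<in>sym_ptensor. X \<rho>)" by auto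
    with X(4) have "?f P \<in> V" by (rule subsetD)
    with P show "P \<in> U" unfolding V(2) by simp
  qed
  with F \<open>e > 0\<close> that show ?thesis by blast
qed

lemma locally_convex_weak_star:
  "locally_convex_space (weak_star :: ('a::real_normed_vector \<Rightarrow>\<^sub>L 'a \<Rightarrow>\<^sub>L real) topology)"
  (is "locally_convex_space ?W")
  unfolding locally_convex_space_def topspace_weak_star
proof (intro conjI allI impI)
  show "subspace (sym_ops :: ('a \<Rightarrow>\<^sub>L 'a \<Rightarrow>\<^sub>L real) set)" by (rule subspace_sym_ops)
  show "continuous_map (prod_topology ?W ?W) ?W (\<lambda>(P, Q). P + Q)"
  proof (rule continuous_map_into_weak_star)
    fix \<rho> :: "'a ptensor" assume \<rho>: "\<rho> \<in> sym_ptensor"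
    have "continuous_map (prod_topology weak_star weak_star) euclideanreal
        (\<lambda>z. pairing (fst z) \<rho> + pairing (snd z) \<rho>)"
      using continuous_map_compose[OF continuous_map_fst continuous_map_weak_star_pairing[OF \<rho>]]
        continuous_map_compose[OF continuous_map_snd continuous_map_weak_star_pairing[OF \<rho>]]
      by (intro continuous_map_add) (simp_all add: o_def)
    then show "continuous_map (prod_topology weak_star weak_star) euclideanreal
        (\<lambda>z. pairing (case z of (P, Q) \<Rightarrow> P + Q) \<rho>)"
      by (simp add: case_prod_unfold linear_add[OF linear_pairing_left])
  qed (auto intro: subspace_add[OF subspace_sym_ops])
  show "continuous_map (prod_topology euclideanreal ?W) ?W (\<lambda>(c, P). c *\<^sub>R P)"
  proof (rule continuous_map_into_weak_star)
    fix \<rho> :: "'a ptensor" assume \<rho>: "\<rho> \<in> sym_ptensor"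
    have "continuous_map (prod_topology euclideanreal weak_star) euclideanreal
        (\<lambda>z. fst z * pairing (snd z) \<rho>)"
      using continuous_map_compose[OF continuous_map_snd continuous_map_weak_star_pairing[OF \<rho>]]
      by (intro continuous_map_real_mult continuous_map_fst) (simp_all add: o_def)
    then show "continuous_map (prod_topology euclideanreal weak_star) euclideanreal
        (\<lambda>z. pairing (case z of (c, P) \<Rightarrow> c *\<^sub>R P) \<rho>)"
      by (simp add: case_prod_unfold linear_scale[OF linear_pairing_left])
  qed (auto intro: subspace_mul[OF subspace_sym_ops])
next
  fix U :: "('a \<Rightarrow>\<^sub>L 'a \<Rightarrow>\<^sub>L real) set"
  assume "openin weak_star U \<and> 0 \<in> U"
  then obtain F e where F: "finite F" "F \<subseteq> sym_ptensor" "e > 0"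
    "{P \<in> sym_ops. \<forall>\<rho>\<in>F. \<bar>pairing P \<rho>\<bar> < e} \<subseteq> U" (is "?S \<subseteq> U")
    using weak_star_nbhd_0 by blast
  have "?S = sym_ops \<inter> (\<Inter>\<rho>\<in>F. (\<lambda>P. pairing P \<rho>) -` {- e<..<e})"
    by (auto simp: abs_less_iff)
  also have "convex \<dots>"
    by (rule convex_Int[OF subspace_imp_convex[OF subspace_sym_ops] convex_INT],
        rule convex_linear_vimage[OF linear_pairing_left]) simp
  finally have "convex ?S" .
  moreover have "0 \<in> ?S"
    using F subspace_0[OF subspace_sym_ops] by (simp add: linear_0[OF linear_pairing_left])
  ultimately show "\<exists>W. openin weak_star W \<and> convex W \<and> 0 \<in> W \<and> W \<subseteq> U"
    using openin_weak_star_strip[OF F(1,2)] F(4) by blast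
qed

text \<open>Weak* boundedness bounds each entry \<open>P x y\<close> over \<open>B\<close>. The
  Banach-Steinhaus theorem is then used once per argument: first for the functionals
  \<open>P x\<close> with \<open>x\<close> fixed, then for the operators \<open>P\<close>.\<close>

lemma bounded_in_weak_star_norm_bounded:
  fixes B :: "('a::banach \<Rightarrow>\<^sub>L 'a \<Rightarrow>\<^sub>L real) set"
  assumes B: "bounded_in weak_star B"
  obtains K where "K \<ge> 0" "\<And>P. P \<in> B \<Longrightarrow> norm P \<le> K"
proof -
  have entry: "\<exists>M. \<forall>P\<in>B. norm (P x y) \<le> M" for x y
  proof -
    let ?\<rho> = "of_tensor (x \<otimes> y) + of_tensor (y \<otimes> x)"
    define U where "U = {P \<in> sym_ops. \<forall>\<rho>\<in>{?\<rho>}. \<bar>pairing P \<rho>\<bar> < 1}"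
    have "openin weak_star U"
      unfolding U_def by (rule openin_weak_star_strip) (auto simp: sym_elem_in_sym_ptensor)
    moreover have "0 \<in> U"
      using subspace_0[OF subspace_sym_ops] by (simp add: U_def linear_0[OF linear_pairing_left])
    ultimately have "\<exists>r>0. \<forall>c. r \<le> \<bar>c\<bar> \<longrightarrow> B \<subseteq> (*\<^sub>R) c ` U"
      using B by (simp add: bounded_in_def)
    then obtain r where r: "r > 0" "B \<subseteq> (*\<^sub>R) r ` U"
      by fastforce
    have "norm (P x y) \<le> r" if PB: "P \<in> B" for P
    proof -
      obtain Q where Q: "P = r *\<^sub>R Q" "Q \<in> U"
        using subsetD[OF r(2) PB] by (rule imageE)
      from Q(2) have "Q \<in> sym_ops" "\<bar>pairing Q ?\<rho>\<bar> < 1"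
        unfolding U_def by auto
      \<comment> \<open>For symmetric \<open>Q\<close> the pairing with the symmetrized tensor is
        \<open>2 * Q x y\<close>.\<close>
      then have "\<bar>Q x y\<bar> \<le> 1"
        unfolding pairing_sym_elem by (auto simp: sym_ops_def)
      then show ?thesis
        using r(1) by (simp add: Q(1) blinfun.bilinear_simps abs_mult mult_left_le)
    qed
    then show ?thesis by blast
  qed
  have "\<exists>M. \<forall>P\<in>B. norm (P x) \<le> M" for x
  proof -
    have "\<exists>M. \<forall>f\<in>(\<lambda>P. blinfun_apply P x) ` B. norm (blinfun_apply f y) \<le> M" for y
      using entry[of x y] by simp
    from banach_steinhaus[OF this] show ?thesis by simp
  qed
  from banach_steinhaus[OF this] obtain K where "\<And>P. P \<in> B \<Longrightarrow> norm P \<le> K"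
    by blast
  then show ?thesis using that[of "max 0 K"] by (auto simp: le_max_iff_disj)
qed

section \<open>The Lyapunov semigroup and its preadjoint\<close>

lemma lyapunov_in_sym_ops: "P \<in> sym_ops \<Longrightarrow> lyapunov_semigroup T t P \<in> sym_ops"
  by (auto simp: sym_ops_def lyapunov_semigroup_apply)

lemma pairing_lyapunov: "pairing (lyapunov_semigroup T t P) \<rho> = pairing P (ptensor_map (T t) \<rho>)"
  by (rule pairing_ptensor_map) (rule lyapunov_semigroup_apply)

text \<open>Existence is the duality in \<open>pairing_lyapunov\<close>; uniqueness holds because
  symmetric operators separate symmetric tensors.\<close>

lemma predual_adjoint_lyapunov:
  assumes "\<rho> \<in> sym_ptensor"
  shows "predual_adjoint (lyapunov_semigroup T t) \<rho> = ptensor_map (T t) \<rho>"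
  unfolding predual_adjoint_def pairing_lyapunov
proof (rule the_equality)
  show "ptensor_map (T t) \<rho> \<in> sym_ptensor \<and>
      (\<forall>P\<in>sym_ops. pairing P (ptensor_map (T t) \<rho>) = pairing P (ptensor_map (T t) \<rho>))"
    by (simp add: ptensor_map_sym assms)
  show "\<sigma> = ptensor_map (T t) \<rho>"
    if "\<sigma> \<in> sym_ptensor \<and> (\<forall>P\<in>sym_ops. pairing P (ptensor_map (T t) \<rho>) = pairing P \<sigma>)" for \<sigma>
    using that by (intro sym_ops_separate ptensor_map_sym assms) auto
qed

lemma continuous_linear_op_lyapunov: "continuous_linear_op weak_star (lyapunov_semigroup T t)"
  unfolding continuous_linear_op_def
proof (intro conjI ballI allI)
  show "continuous_map weak_star weak_star (lyapunov_semigroup T t)"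
    by (rule continuous_map_into_weak_star)
       (auto simp: pairing_lyapunov lyapunov_in_sym_ops
         intro: continuous_map_weak_star_pairing ptensor_map_sym)
qed (auto intro!: blinfun_eqI simp: lyapunov_semigroup_apply blinfun.bilinear_simps)

lemma norm_lyapunov_le: "norm (lyapunov_semigroup T t P) \<le> norm P * (norm (T t) * norm (T t))"
proof (intro norm_blinfun_bound)
  fix x y
  have "norm (lyapunov_semigroup T t P x y) \<le> norm P * norm (T t x) * norm (T t y)"
    unfolding lyapunov_semigroup_apply
    by (rule order_trans[OF norm_blinfun mult_right_mono[OF norm_blinfun norm_ge_zero]])
  also have "\<dots> \<le> norm P * (norm (T t) * norm x) * (norm (T t) * norm y)"
    by (intro mult_mono mult_left_mono norm_blinfun) auto
  finally show "norm (lyapunov_semigroup T t P x y) \<le> norm P * (norm (T t) * norm (T t)) * norm x * norm y"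
    by (simp add: mult_ac)
qed auto

text \<open>A weak* continuous seminorm is controlled by finitely many of the functionals \<open>\<lambda>P. pairing P \<rho>\<close>.\<close>

lemma lyapunov_seminorm_bounded:
  fixes T :: "real \<Rightarrow> 'a::banach \<Rightarrow>\<^sub>L 'a"
  assumes T: "C0_semigroup T" and p: "continuous_seminorm weak_star p" and B: "bounded_in weak_star B"
  shows "\<exists>M. \<forall>P\<in>B. \<forall>t\<in>{0..a}. p (lyapunov_semigroup T t P) \<le> M"
proof -
  obtain K where K: "K \<ge> 0" "\<And>P. P \<in> B \<Longrightarrow> norm P \<le> K"
    using bounded_in_weak_star_norm_bounded[OF B] by blast
  obtain N where N: "\<forall>t\<in>{0..a}. norm (T t) \<le> N"
    using C0_semigroup_locally_bounded[OF T] by blast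
  have sub: "B \<subseteq> sym_ops" using B by (simp add: bounded_in_def)
  have cont: "continuous_map weak_star euclideanreal p"
    and scale: "\<And>c P. P \<in> sym_ops \<Longrightarrow> p (c *\<^sub>R P) = \<bar>c\<bar> * p P"
    using p by (auto simp: continuous_seminorm_def)
  have 0: "(0 :: 'a \<Rightarrow>\<^sub>L 'a \<Rightarrow>\<^sub>L real) \<in> sym_ops" by (rule subspace_0[OF subspace_sym_ops])
  let ?U = "{P \<in> topspace weak_star. p P \<in> {..<1}}"
  have "openin weak_star ?U"
    by (rule openin_continuous_map_preimage[OF cont]) auto
  moreover have "0 \<in> ?U" using 0 scale[OF 0, of 0] by simp
  ultimately obtain F e where F: "finite F" "F \<subseteq> sym_ptensor" "e > 0"
    "{P \<in> sym_ops. \<forall>\<rho>\<in>F. \<bar>pairing P \<rho>\<bar> < e} \<subseteq> ?U"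
    by (rule weak_star_nbhd_0)
  \<comment> \<open>A strict upper bound for the pairings of all operators in the orbits up to time
    \<open>a\<close> with the tensors in \<open>F\<close>; the summand 1 makes it strict and
    positive.\<close>
  define C where "C = K * (N * N) * (\<Sum>\<rho>\<in>F. norm \<rho>) + 1"
  have "p (lyapunov_semigroup T t P) \<le> C / e" if P: "P \<in> B" and t: "t \<in> {0..a}" for P t
  proof -
    let ?Q = "lyapunov_semigroup T t P"
    have Q: "?Q \<in> sym_ops" using P sub by (auto intro: lyapunov_in_sym_ops)
    have N0: "0 \<le> N" using N t norm_ge_zero order_trans by blast
    have "norm ?Q \<le> K * (N * N)"
      by (rule order_trans[OF norm_lyapunov_le]) (use K P N t N0 in \<open>auto intro!: mult_mono\<close>)
    moreover have "norm \<rho> \<le> (\<Sum>\<rho>\<in>F. norm \<rho>)" if "\<rho> \<in> F" for \<rho>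
      using F that by (intro member_le_sum) auto
    ultimately have "norm ?Q * norm \<rho> \<le> K * (N * N) * (\<Sum>\<rho>\<in>F. norm \<rho>)" if "\<rho> \<in> F" for \<rho>
      using that K by (intro mult_mono) auto
    then have "\<bar>pairing ?Q \<rho>\<bar> < C" if "\<rho> \<in> F" for \<rho>
      using that abs_pairing_le[of ?Q \<rho>] unfolding C_def by fastforce
    moreover have C: "C > 0"
      using K by (simp add: C_def add_nonneg_pos sum_nonneg)
    ultimately have "\<bar>pairing ((e / C) *\<^sub>R ?Q) \<rho>\<bar> < e" if "\<rho> \<in> F" for \<rho>
      using that F(3) by (simp add: linear_scale[OF linear_pairing_left] abs_mult pos_divide_less_eq)
    \<comment> \<open>Scaling by \<open>e / C\<close> moves the orbit into the region where
      \<open>p\<close> is below 1; homogeneity of \<open>p\<close> undoes the scaling.\<close>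
    then have "(e / C) *\<^sub>R ?Q \<in> ?U"
      using F(4) subspace_mul[OF subspace_sym_ops Q] by blast
    then show ?thesis
      using scale[OF Q, of "e / C"] C F(3) by (simp add: field_simps)
  qed
  then show ?thesis by blast
qed

lemma Cb_lyapunov_semigroup:
  fixes T :: "real \<Rightarrow> 'a::banach \<Rightarrow>\<^sub>L 'a"
  assumes T: "C0_semigroup T"
  shows "Cb_semigroup weak_star (lyapunov_semigroup T)"
  unfolding Cb_semigroup_def topspace_weak_star
proof (intro conjI allI impI ballI)
  fix P :: "'a \<Rightarrow>\<^sub>L 'a \<Rightarrow>\<^sub>L real" assume P: "P \<in> sym_ops"
  show "lyapunov_semigroup T 0 P = P"
    using T by (intro blinfun_eqI) (simp add: lyapunov_semigroup_apply C0_semigroup_def)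
  show "lyapunov_semigroup T (t + s) P = lyapunov_semigroup T t (lyapunov_semigroup T s P)"
    if "0 \<le> t" "0 \<le> s" for t s
  proof -
    \<comment> \<open>Applying the time \<open>s\<close> operator first puts \<open>T s\<close> next
      to \<open>P\<close>, so the factors appear in the opposite order and commutativity of addition
      is used.\<close>
    have "T (t + s) = T s o\<^sub>L T t"
      using T that unfolding C0_semigroup_def by (metis add.commute)
    then show ?thesis by (intro blinfun_eqI) (simp add: lyapunov_semigroup_apply)
  qed
  show "continuous_map (top_of_set {0..}) weak_star (\<lambda>t. lyapunov_semigroup T t P)"
  proof (rule continuous_map_into_weak_star)
    show "lyapunov_semigroup T t P \<in> sym_ops" for t by (rule lyapunov_in_sym_ops[OF P])
    show "continuous_map (top_of_set {0..}) euclideanreal (\<lambda>t. pairing (lyapunov_semigroup T t P) \<rho>)" for \<rho>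
      by (simp add: pairing_lyapunov bounded_linear.continuous_on[OF bounded_linear_pairing]
          C0_semigroup_continuous_on[OF C0_semigroup_ptensor_map[OF T]])
  qed
qed (use locally_convex_weak_star continuous_linear_op_lyapunov lyapunov_seminorm_bounded[OF T] in auto)

theorem theorem5:
  fixes T :: "real \<Rightarrow> 'a::banach \<Rightarrow>\<^sub>L 'a"
  assumes "C0_semigroup T"
  shows "(sym_ptensor :: 'a ptensor set) = {\<rho> - \<sigma> | \<rho> \<sigma>. \<rho> \<in> pos_cone \<and> \<sigma> \<in> pos_cone} \<and>
    Cb_semigroup weak_star (lyapunov_semigroup T) \<and>
    positive_semigroup (lyapunov_semigroup T) \<and>
    pi_compatible (lyapunov_semigroup T)"
proof (intro conjI)
  show "(sym_ptensor :: 'a ptensor set) = {\<rho> - \<sigma> | \<rho> \<sigma>. \<rho> \<in> pos_cone \<and> \<sigma> \<in> pos_cone}"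
    by (rule pos_cone_generating)
  show "Cb_semigroup weak_star (lyapunov_semigroup T)"
    by (rule Cb_lyapunov_semigroup[OF assms])
  \<comment> \<open>The quadratic form of the new operator at \<open>x\<close> is that of
    \<open>P\<close> at \<open>T t x\<close>.\<close>
  show "positive_semigroup (lyapunov_semigroup T)"
    by (auto simp: positive_semigroup_def pos_sym_ops_def lyapunov_in_sym_ops lyapunov_semigroup_apply)
  show "pi_compatible (lyapunov_semigroup T)"
    unfolding pi_compatible_def
  proof
    fix \<rho> :: "'a ptensor" assume "\<rho> \<in> pos_cone"
    then have "\<rho> \<in> sym_ptensor" by (simp add: pos_cone_def)
    \<comment> \<open>On symmetric tensors the adjoint is \<open>ptensor_map (T t)\<close>, whose
      orbits are norm continuous.\<close>
    then show "continuous_on {0..} (\<lambda>t. norm (predual_adjoint (lyapunov_semigroup T t) \<rho>))"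
      by (simp add: predual_adjoint_lyapunov continuous_on_norm
          C0_semigroup_continuous_on[OF C0_semigroup_ptensor_map[OF assms]])
  qed
qed

end
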